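(* If $Q$ is a finite power-associative CC-loop whose order $|Q|$ is relatively prime to $6$, then $Q$ is a group.
   Context: A loop is a set $Q$ with a binary operation having a two-sided identity $1$ such that all equations $xu=y$ and $vx=y$ have unique solutions $u,v$. A loop $Q$ is conjugacy closed (a CC-loop) if there are functions $f,g:Q\times Q\to Q$ such that for all $x,y,z\in Q$: $x(yz)=f(x,y)(xz)$ and $(zy)x=(zx)g(x,y)$. A loop is power-associative if for each $x$ the subloop $\langle x\rangle$ generated by $x$ is a group. *)

theory Defs
  imports "HOL-Algebra.Coset"
begin

text \<open>Loops are carried by the same records as the groups of HOL-Algebra, so that being a group
  is literally the library predicate \<^const>\<open>group\<close> on the same record.\<close>

locale loop =
  fixes Q (structure)
  assumes m_closed: "\<lbrakk>x \<in> carrier Q; y \<in> carrier Q\<rbrakk> \<Longrightarrow> x \<otimes> y \<in> carrier Q"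
    and one_closed: "\<one> \<in> carrier Q"
    and l_one: "x \<in> carrier Q \<Longrightarrow> \<one> \<otimes> x = x"
    and r_one: "x \<in> carrier Q \<Longrightarrow> x \<otimes> \<one> = x"
    and l_division: "\<lbrakk>x \<in> carrier Q; y \<in> carrier Q\<rbrakk> \<Longrightarrow> \<exists>!u. u \<in> carrier Q \<and> x \<otimes> u = y"
    and r_division: "\<lbrakk>x \<in> carrier Q; y \<in> carrier Q\<rbrakk> \<Longrightarrow> \<exists>!v. v \<in> carrier Q \<and> v \<otimes> x = y"

locale cc_loop = loop +
  assumes conjugacy_closed:
    "\<exists>f \<in> carrier Q \<rightarrow> carrier Q \<rightarrow> carrier Q. \<exists>g \<in> carrier Q \<rightarrow> carrier Q \<rightarrow> carrier Q.
       \<forall>x \<in> carrier Q. \<forall>y \<in> carrier Q. \<forall>z \<in> carrier Q.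
         x \<otimes> (y \<otimes> z) = f x y \<otimes> (x \<otimes> z) \<and> (z \<otimes> y) \<otimes> x = (z \<otimes> x) \<otimes> g x y"

definition subloop :: "'a set \<Rightarrow> ('a, 'b) monoid_scheme \<Rightarrow> bool"
  where "subloop H Q \<longleftrightarrow> H \<subseteq> carrier Q \<and> loop (Q\<lparr>carrier := H\<rparr>)"

definition subloop_generated :: "('a, 'b) monoid_scheme \<Rightarrow> 'a set \<Rightarrow> 'a set"
  where "subloop_generated Q S = \<Inter>{H. subloop H Q \<and> S \<subseteq> H}"

lemma (in loop) subloop_subloop_generated:
  assumes "S \<subseteq> carrier Q"
  shows "subloop (subloop_generated Q S) Q"
proof -
  define K where "K = subloop_generated Q S"
  have K_D: "x \<in> H" if "x \<in> K" "H \<subseteq> carrier Q" "loop (Q\<lparr>carrier := H\<rparr>)" "S \<subseteq> H" for x H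
    using that by (simp add: K_def subloop_generated_def subloop_def)
  have K_I: "x \<in> K"
    if "\<And>H. H \<subseteq> carrier Q \<Longrightarrow> loop (Q\<lparr>carrier := H\<rparr>) \<Longrightarrow> S \<subseteq> H \<Longrightarrow> x \<in> H" for x
    using that by (simp add: K_def subloop_generated_def subloop_def)
  have "loop (Q\<lparr>carrier := carrier Q\<rparr>)" using loop_axioms by simp
  then have sub: "K \<subseteq> carrier Q" using K_D[OF _ subset_refl _ assms] by (intro subsetI)
  have ldiv: "\<exists>!u. u \<in> K \<and> x \<otimes> u = y" if x: "x \<in> K" and y: "y \<in> K" for x y
  proof -
    have xy: "x \<in> carrier Q" "y \<in> carrier Q" using x y sub by auto
    from l_division[OF xy] obtain u where u: "u \<in> carrier Q" "x \<otimes> u = y"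
      and uniq: "\<And>v. v \<in> carrier Q \<Longrightarrow> x \<otimes> v = y \<Longrightarrow> v = u"
      by (elim ex1E) auto
    have "u \<in> K"
    proof (rule K_I)
      fix H assume H: "H \<subseteq> carrier Q" "loop (Q\<lparr>carrier := H\<rparr>)" "S \<subseteq> H"
      have "x \<in> H" "y \<in> H" using K_D[OF x H] K_D[OF y H] .
      then have "\<exists>!v. v \<in> H \<and> x \<otimes> v = y"
        using loop.l_division[OF H(2), of x y] by simp
      then obtain v where v: "v \<in> H" "x \<otimes> v = y" by (elim ex1E) auto
      then have "v = u" using uniq H(1) by auto
      then show "u \<in> H" using v by simp
    qed
    show ?thesis
    proof (rule ex1I)
      show "u \<in> K \<and> x \<otimes> u = y" using \<open>u \<in> K\<close> u by simp
    next
      fix v assume "v \<in> K \<and> x \<otimes> v = y"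
      then show "v = u" using uniq sub by auto
    qed
  qed
  have rdiv: "\<exists>!u. u \<in> K \<and> u \<otimes> x = y" if x: "x \<in> K" and y: "y \<in> K" for x y
  proof -
    have xy: "x \<in> carrier Q" "y \<in> carrier Q" using x y sub by auto
    from r_division[OF xy] obtain u where u: "u \<in> carrier Q" "u \<otimes> x = y"
      and uniq: "\<And>v. v \<in> carrier Q \<Longrightarrow> v \<otimes> x = y \<Longrightarrow> v = u"
      by (elim ex1E) auto
    have "u \<in> K"
    proof (rule K_I)
      fix H assume H: "H \<subseteq> carrier Q" "loop (Q\<lparr>carrier := H\<rparr>)" "S \<subseteq> H"
      have "x \<in> H" "y \<in> H" using K_D[OF x H] K_D[OF y H] .
      then have "\<exists>!v. v \<in> H \<and> v \<otimes> x = y"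
        using loop.r_division[OF H(2), of x y] by simp
      then obtain v where v: "v \<in> H" "v \<otimes> x = y" by (elim ex1E) auto
      then have "v = u" using uniq H(1) by auto
      then show "u \<in> H" using v by simp
    qed
    show ?thesis
    proof (rule ex1I)
      show "u \<in> K \<and> u \<otimes> x = y" using \<open>u \<in> K\<close> u by simp
    next
      fix v assume "v \<in> K \<and> v \<otimes> x = y"
      then show "v = u" using uniq sub by auto
    qed
  qed
  have "loop (Q\<lparr>carrier := K\<rparr>)"
  proof (rule loop.intro, goal_cases)
    case (1 x y)
    then have x: "x \<in> K" and y: "y \<in> K" by simp_all
    have "x \<otimes> y \<in> K"
    proof (rule K_I)
      fix H assume H: "H \<subseteq> carrier Q" "loop (Q\<lparr>carrier := H\<rparr>)" "S \<subseteq> H"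
      show "x \<otimes> y \<in> H"
        using loop.m_closed[OF H(2), of x y] K_D[OF x H] K_D[OF y H] by simp
    qed
    then show ?case by simp
  next
    case 2
    have "\<one> \<in> K"
    proof (rule K_I)
      fix H assume "loop (Q\<lparr>carrier := H\<rparr>)"
      then show "\<one> \<in> H" using loop.one_closed[of "Q\<lparr>carrier := H\<rparr>"] by simp
    qed
    then show ?case by simp
  next
    case (3 x) then show ?case using l_one[of x] sub by auto
  next
    case (4 x) then show ?case using r_one[of x] sub by auto
  next
    case (5 x y) then show ?case using ldiv[of x y] by simp
  next
    case (6 x y) then show ?case using rdiv[of x y] by simp
  qed
  then show ?thesis
    using sub by (simp add: subloop_def K_def)
qed

definition power_associative :: "('a, 'b) monoid_scheme \<Rightarrow> bool"
  where "power_associative Q \<longleftrightarrow>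
    (\<forall>x \<in> carrier Q. group (Q\<lparr>carrier := subloop_generated Q {x}\<rparr>))"

end

theory Submission
  imports Defs "HOL-Algebra.Multiplicative_Group"
begin

text \<open>
  Write \<open>N\<close> for the nucleus and \<open>Z\<close> for its center.
  Conjugacy closedness supplies, for every \<open>P\<close> in the left multiplication group, an autotopism
  \<open>(A, P, P)\<close>, and for every \<open>P\<close> in the right multiplication group an autotopism
  \<open>(P, B, P)\<close>. Two autotopisms with the same third component differ by a middle nuclear
  element, so every \<open>P\<close> in the intersection of the two groups maps \<open>1\<close> into \<open>Z\<close>. This puts all
  associators into \<open>Z\<close>, and a similar comparison shows that \<open>Q/N\<close> is commutative (Basarab).
  Hence the associator is a \<open>3\<close>-cocycle of the abelian group \<open>Q/N\<close> with values in \<open>Z\<close>, and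
  conjugacy closedness makes it symmetric in its three arguments.
  A symmetric cocycle satisfies \<open>a(xy,z,w) = a(x,z,w) + a(y,z,w)\<^sup>x\<close>;
  expanding \<open>a(xy,xy,xy) = 0\<close>, which power-associativity provides, gives \<open>12 a = 0\<close>.
  Since \<open>|Z|\<close> divides \<open>|Q|\<close>, it is prime to \<open>6\<close>, so all associators are trivial.
\<close>

section \<open>Symmetric cocycles\<close>

text \<open>The index set \<open>X\<close> is meant to be the loop and not its quotient by the
  nucleus, so commutativity of the quotient is expressed by \<open>a_mul_comm\<close>, as invariance
  of \<open>a\<close>. The map \<open>act c x\<close> models the conjugate of \<open>c\<close> by
  \<open>x\<close>, written as a right action by endomorphisms.\<close>

locale symmetric_cocycle = comm_group M for M :: "('m, 'c) monoid_scheme" (structure) +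
  fixes X :: "'x set" and mul :: "'x \<Rightarrow> 'x \<Rightarrow> 'x" (infixl "\<cdot>" 70)
    and a :: "'x \<Rightarrow> 'x \<Rightarrow> 'x \<Rightarrow> 'm" and act :: "'m \<Rightarrow> 'x \<Rightarrow> 'm"
  assumes mul_closed [simp]: "x \<in> X \<Longrightarrow> y \<in> X \<Longrightarrow> x \<cdot> y \<in> X"
    and a_closed [simp]: "x \<in> X \<Longrightarrow> y \<in> X \<Longrightarrow> z \<in> X \<Longrightarrow> a x y z \<in> carrier M"
    and act_closed [simp]: "c \<in> carrier M \<Longrightarrow> x \<in> X \<Longrightarrow> act c x \<in> carrier M"
    and act_mult: "c \<in> carrier M \<Longrightarrow> d \<in> carrier M \<Longrightarrow> x \<in> X
      \<Longrightarrow> act (c \<otimes> d) x = act c x \<otimes> act d x"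
    and a_comm_left: "x \<in> X \<Longrightarrow> y \<in> X \<Longrightarrow> z \<in> X \<Longrightarrow> a x y z = a y x z"
    and a_comm_right: "x \<in> X \<Longrightarrow> y \<in> X \<Longrightarrow> z \<in> X \<Longrightarrow> a x y z = a x z y"
    and a_mul_comm: "x \<in> X \<Longrightarrow> y \<in> X \<Longrightarrow> z \<in> X \<Longrightarrow> w \<in> X
      \<Longrightarrow> a (x \<cdot> y) z w = a (y \<cdot> x) z w"
    and cocycle: "x \<in> X \<Longrightarrow> y \<in> X \<Longrightarrow> z \<in> X \<Longrightarrow> w \<in> X
      \<Longrightarrow> a x y (z \<cdot> w) \<otimes> a (x \<cdot> y) z w = a y z w \<otimes> a x (y \<cdot> z) w \<otimes> act (a x y z) w"
begin

section \<open>The product rule for symmetric cocycles\<close>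

lemma a_rotate: "x \<in> X \<Longrightarrow> y \<in> X \<Longrightarrow> z \<in> X \<Longrightarrow> a x y z = a z x y"
  using a_comm_left[of x z y] a_comm_right[of x y z] by simp

text \<open>Normal form of the cocycle identity, with every product moved to the first argument so
  that symmetric variants can be compared by cancellation.\<close>

lemma cocycle':
  assumes "x \<in> X" "y \<in> X" "z \<in> X" "w \<in> X"
  shows "a (z \<cdot> w) x y \<otimes> a (x \<cdot> y) z w = a y z w \<otimes> a (y \<cdot> z) x w \<otimes> act (a x y z) w"
  using cocycle[OF assms] a_rotate[of x y "z \<cdot> w"] a_comm_left[of x "y \<cdot> z" w] assms by simp

text \<open>Reversing the order of \<open>x, y, z, w\<close> preserves the left side of
  \<open>cocycle'\<close> and the term \<open>a (y \<cdot> z) x w\<close>. Comparing what remains of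
  the two right sides gives the identity.\<close>

lemma act_a_swap:
  assumes [simp]: "x \<in> X" "y \<in> X" "z \<in> X" "w \<in> X"
  shows "a y z w \<otimes> act (a x y z) w = a x y z \<otimes> act (a y z w) x"
proof -
  have e1: "a w z y = a y z w" "a z y x = a x y z"
    by (metis a_comm_left a_comm_right assms)+
  have e2: "a (y \<cdot> x) w z = a (x \<cdot> y) z w" "a (w \<cdot> z) y x = a (z \<cdot> w) x y"
    "a (z \<cdot> y) w x = a (y \<cdot> z) x w"
    by (metis a_comm_right a_mul_comm assms mul_closed)+
  have "a (y \<cdot> z) x w \<otimes> (a y z w \<otimes> act (a x y z) w) = a (z \<cdot> w) x y \<otimes> a (x \<cdot> y) z w"
    using cocycle'[of x y z w] by (simp add: m_ac)
  also have "\<dots> = a (y \<cdot> z) x w \<otimes> (a x y z \<otimes> act (a y z w) x)"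
    using cocycle'[of w z y x] by (simp add: e1 e2 m_ac)
  finally show ?thesis by simp
qed

text \<open>Each splitting of the four arguments into two pairs yields a sum such as
  \<open>S\<close>, where each pair in turn is multiplied into one argument. Symmetry of the right
  sides of \<open>cocycle'\<close> shows that the three splittings have the same sum
  (\<open>c2\<close>, \<open>c4\<close>). Combining this with the individual cocycle identities
  isolates a single term with a product.\<close>

lemma a_mul:
  assumes [simp]: "x \<in> X" "y \<in> X" "z \<in> X" "w \<in> X"
  shows "a (x \<cdot> y) z w = a x z w \<otimes> act (a y z w) x"
proof -
  note cl = assms mul_closed
  define S where "S = a (x \<cdot> y) z w \<otimes> a (z \<cdot> w) x y"
  have [simp]: "S \<in> carrier M" by (simp add: S_def)
  have a_eqs: "a y x z = a x y z" "a z x y = a x y z" "a x z y = a x y z"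
    "a y x w = a x y w" "a x w z = a x z w" "a z y w = a y z w"
    by (metis a_comm_left a_comm_right assms)+
  have s_eqs: "a (z \<cdot> x) y w = a (x \<cdot> z) y w" "a (y \<cdot> x) z w = a (x \<cdot> y) z w"
    "a (y \<cdot> x) w z = a (x \<cdot> y) z w" "a (x \<cdot> w) z y = a (x \<cdot> w) y z"
    "a (y \<cdot> z) w x = a (y \<cdot> z) x w" "a (w \<cdot> z) y x = a (z \<cdot> w) x y"
    "a (y \<cdot> w) z x = a (y \<cdot> w) x z" "a (z \<cdot> y) x w = a (y \<cdot> z) x w"
    "a (w \<cdot> y) x z = a (y \<cdot> w) x z" "a (x \<cdot> w) y z = a (w \<cdot> x) y z"
    by (metis a_comm_right a_mul_comm cl)+
  have c1: "S = a y z w \<otimes> a (y \<cdot> z) x w \<otimes> act (a x y z) w"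
    using cocycle'[of x y z w] by (simp add: S_def m_ac)
  have c2: "a (x \<cdot> z) y w \<otimes> a (y \<cdot> w) x z = S"
    using cocycle'[of x z y w] by (simp add: c1 a_eqs s_eqs m_ac)
  have c3: "S = a x z w \<otimes> a (x \<cdot> w) y z \<otimes> act (a x y w) z"
    using cocycle'[of y x w z] by (simp add: S_def a_eqs s_eqs m_ac)
  have c4: "a (x \<cdot> w) y z \<otimes> a (y \<cdot> z) x w = S"
  proof -
    have "a (x \<cdot> w) y z \<otimes> a (y \<cdot> z) x w = a x z w \<otimes> a (x \<cdot> z) y w \<otimes> act (a x y z) w"
      using cocycle'[of y z x w] a_comm_left[of z x w] a_rotate[of y z x] by (simp add: a_eqs s_eqs m_ac)
    also have "\<dots> = S"
      using cocycle'[of y x z w] a_comm_right[of "z \<cdot> w" y x] by (simp add: S_def a_eqs s_eqs m_ac)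
    finally show ?thesis .
  qed
  have c5: "S = a x y w \<otimes> a (x \<cdot> y) z w \<otimes> act (a x y z) w"
    using cocycle'[of z x y w] c2 by (simp add: a_eqs s_eqs m_ac)
  \<comment> \<open>Multiplying \<open>c1\<close> by \<open>c3\<close> brings together the two terms
    of the splitting \<open>xw | yz\<close>, whose product is again \<open>S\<close> by
    \<open>c4\<close>; one \<open>S\<close> then cancels, leaving a formula without products of
    arguments.\<close>
  have "S \<otimes> S = S \<otimes> (a x z w \<otimes> act (a x y w) z \<otimes> a y z w \<otimes> act (a x y z) w)"
  proof -
    have "S \<otimes> S = (a y z w \<otimes> a (y \<cdot> z) x w \<otimes> act (a x y z) w) \<otimes> (a x z w \<otimes> a (x \<cdot> w) y z \<otimes> act (a x y w) z)"
      using c1 c3 by simp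
    also have "\<dots> = (a (x \<cdot> w) y z \<otimes> a (y \<cdot> z) x w) \<otimes> (a x z w \<otimes> act (a x y w) z \<otimes> a y z w \<otimes> act (a x y z) w)"
      by (simp add: m_ac)
    finally show ?thesis by (simp only: c4)
  qed
  then have "S = a x z w \<otimes> act (a x y w) z \<otimes> a y z w \<otimes> act (a x y z) w"
    by simp
  then have "act (a x y z) w \<otimes> (a x y w \<otimes> a (x \<cdot> y) z w)
      = act (a x y z) w \<otimes> (a x z w \<otimes> (a y z w \<otimes> act (a x y w) z))"
    using c5 by (simp add: m_ac)
  then have "a x y w \<otimes> a (x \<cdot> y) z w = a x z w \<otimes> (a y z w \<otimes> act (a x y w) z)"
    by simp
  also have "a y z w \<otimes> act (a x y w) z = a x y w \<otimes> act (a y z w) x"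
    by (metis a_comm_left a_comm_right act_a_swap assms)
  finally have "a x y w \<otimes> a (x \<cdot> y) z w = a x y w \<otimes> (a x z w \<otimes> act (a y z w) x)"
    by (simp add: m_ac)
  then show ?thesis by simp
qed

end

section \<open>Vanishing of cocycles in the absence of 2- and 3-torsion\<close>

locale alternating_symmetric_cocycle = symmetric_cocycle +
  assumes a_diag: "x \<in> X \<Longrightarrow> a x x x = \<one>"
    and no_2_torsion: "c \<in> carrier M \<Longrightarrow> c \<otimes> c = \<one> \<Longrightarrow> c = \<one>"
    and no_3_torsion: "c \<in> carrier M \<Longrightarrow> c \<otimes> c \<otimes> c = \<one> \<Longrightarrow> c = \<one>"
begin

lemma act_one [simp]:
  assumes [simp]: "x \<in> X"
  shows "act \<one> x = \<one>"
  using act_mult[of \<one> \<one> x] by simp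

text \<open>At the arguments \<open>y, x, x, x\<close>, both terms of \<open>act_a_swap\<close> that
  involve \<open>a x x x\<close> vanish.\<close>

lemma act_a_fixed:
  assumes [simp]: "x \<in> X" "y \<in> X"
  shows "act (a x x y) x = a x x y"
  using act_a_swap[of y x x x] a_rotate[of x x y] by (simp add: a_diag)

text \<open>Expanding \<open>a (x \<cdot> y) (x \<cdot> y) (x \<cdot> y) = \<one>\<close> by the
  product rule leaves a cube, which the absence of 3-torsion removes.\<close>

lemma a_twice_inverse:
  assumes [simp]: "x \<in> X" "y \<in> X"
  shows "a x x y \<otimes> a x y y = \<one>" and "act (a x x y) y = a x x y"
proof -
  define p q where "p = a x x y" and "q = a x y y"
  have [simp]: "p \<in> carrier M" "q \<in> carrier M" by (simp_all add: p_def q_def)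
  have q': "a y y x = q" by (simp add: q_def a_rotate[of y y x])
  have fixed: "act p x = p" "act q y = q"
    using act_a_fixed[of x y] act_a_fixed[of y x] by (simp_all add: p_def q')
  \<comment> \<open>The element \<open>d\<close> measures how far \<open>y\<close> is from fixing
    \<open>p\<close>. By \<open>act_a_swap\<close> it measures equally how far \<open>x\<close> is
    from fixing \<open>q\<close>, so the second claim amounts to \<open>d = \<one>\<close>.\<close>
  obtain d where d [simp]: "d \<in> carrier M" and pd: "act p y = p \<otimes> d"
    using that[of "inv p \<otimes> act p y"] by (simp add: m_assoc[symmetric])
  have "q \<otimes> act p y = p \<otimes> act q x"
    using act_a_swap[of x x y y] by (simp add: p_def q_def)
  then have "p \<otimes> act q x = p \<otimes> (q \<otimes> d)" by (simp add: pd m_ac)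
  then have qd: "act q x = q \<otimes> d" by simp
  \<comment> \<open>As a value with repeated argument \<open>x\<close>, this product is fixed by
    \<open>x\<close>; since \<open>x\<close> fixes \<open>p\<close> too, it fixes
    \<open>d\<close>.\<close>
  have "a x x (y \<cdot> y) = p \<otimes> act p y"
    using a_mul[of y y x x] a_rotate[of x x "y \<cdot> y"] a_rotate[of x x y] by (simp add: p_def)
  then have "act (p \<otimes> act p y) x = p \<otimes> act p y"
    using act_a_fixed[of x "y \<cdot> y"] by simp
  then have "p \<otimes> act (p \<otimes> d) x = p \<otimes> (p \<otimes> d)" by (simp add: act_mult fixed pd)
  then have "p \<otimes> act d x = p \<otimes> d" by (simp add: act_mult fixed)
  then have dx: "act d x = d" by simp
  have e1: "a (x \<cdot> y) x x = p"
    using a_mul[of x y x x] a_rotate[of x x y] fixed(1) by (simp add: a_diag p_def)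
  have e2: "a (x \<cdot> y) y y = q"
    using a_mul[of x y y y] by (simp add: a_diag q_def)
  have e3: "a (x \<cdot> y) x y = p \<otimes> q \<otimes> d"
    using a_mul[of x y x y] a_comm_left[of y x y] by (simp add: p_def[symmetric] q_def[symmetric] qd m_ac)
  have e4: "a (x \<cdot> y) (x \<cdot> y) x = p \<otimes> act (p \<otimes> q \<otimes> d) x"
  proof -
    have "a x (x \<cdot> y) x = a (x \<cdot> y) x x" "a y (x \<cdot> y) x = a (x \<cdot> y) x y"
      by (metis a_comm_left a_comm_right assms mul_closed)+
    then show ?thesis using a_mul[of x y "x \<cdot> y" x] by (simp add: e1 e3)
  qed
  have e5: "a (x \<cdot> y) (x \<cdot> y) y = p \<otimes> q \<otimes> d \<otimes> act q x"
    using a_mul[of x y "x \<cdot> y" y] a_comm_left[of x "x \<cdot> y" y] a_comm_left[of y "x \<cdot> y" y]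
    by (simp add: e2 e3)
  \<comment> \<open>The full expansion on the diagonal element \<open>x \<cdot> y\<close> collects
    to the cube of this element.\<close>
  define r where "r = p \<otimes> q \<otimes> d \<otimes> d"
  have [simp]: "r \<in> carrier M" by (simp add: r_def)
  have "a (x \<cdot> y) (x \<cdot> y) (x \<cdot> y) = (p \<otimes> act (p \<otimes> q \<otimes> d) x) \<otimes> act (p \<otimes> q \<otimes> d \<otimes> act q x) x"
    using a_mul[of x y "x \<cdot> y" "x \<cdot> y"] a_rotate[of "x \<cdot> y" "x \<cdot> y" x]
      a_rotate[of "x \<cdot> y" "x \<cdot> y" y]
    by (simp add: e4 e5)
  also have "\<dots> = r \<otimes> r \<otimes> r"
    by (simp add: r_def act_mult fixed qd dx m_ac)
  finally have "r \<otimes> r \<otimes> r = \<one>" by (simp add: a_diag)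
  then have r: "r = \<one>" by (rule no_3_torsion[rotated]) simp
  \<comment> \<open>Acting by \<open>x\<close> fixes \<open>p\<close> and \<open>d\<close> but
    multiplies \<open>q\<close> by \<open>d\<close>. As \<open>r\<close> is trivial, this forces
    \<open>d\<close> to be trivial.\<close>
  have "act r x = r \<otimes> d"
    by (simp add: r_def act_mult fixed qd dx m_ac)
  then have d1: "d = \<one>" by (simp add: r)
  show "a x x y \<otimes> a x y y = \<one>" using r by (simp add: r_def d1 p_def q_def)
  show "act (a x x y) y = a x x y" using pd by (simp add: d1 p_def)
qed

text \<open>Replacing \<open>y\<close> by \<open>y \<cdot> y\<close> squares \<open>p\<close> but
  raises \<open>q\<close> to the fourth power. Comparing with \<open>p \<otimes> q = \<one>\<close>
  gives \<open>q \<otimes> q = \<one>\<close>, and 2-torsion is excluded.\<close>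

lemma a_twice:
  assumes [simp]: "x \<in> X" "y \<in> X"
  shows "a x x y = \<one>"
proof -
  define p q where "p = a x x y" and "q = a x y y"
  have [simp]: "p \<in> carrier M" "q \<in> carrier M" by (simp_all add: p_def q_def)
  have pq: "p \<otimes> q = \<one>" and py: "act p y = p"
    using a_twice_inverse[of x y] by (simp_all add: p_def q_def)
  have qy: "act q y = q" using act_a_fixed[of y x] a_rotate[of y y x] by (simp add: q_def)
  have "a x x (y \<cdot> y) = p \<otimes> p"
    using a_mul[of y y x x] a_rotate[of x x "y \<cdot> y"] a_rotate[of x x y] py by (simp add: p_def)
  moreover have "a x (y \<cdot> y) (y \<cdot> y) = (q \<otimes> q) \<otimes> (q \<otimes> q)"
  proof -
    have "a (y \<cdot> y) x y = q \<otimes> q"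
      using a_mul[of y y x y] a_comm_left[of x y y] qy by (simp add: q_def)
    then show ?thesis
      using a_mul[of y y x "y \<cdot> y"] a_comm_left[of x "y \<cdot> y" "y \<cdot> y"]
        a_rotate[of y x "y \<cdot> y"] a_comm_right[of "y \<cdot> y" y x] by (simp add: act_mult qy)
  qed
  ultimately have "(p \<otimes> p) \<otimes> ((q \<otimes> q) \<otimes> (q \<otimes> q)) = \<one>"
    using a_twice_inverse(1)[of x "y \<cdot> y"] by simp
  moreover have "(p \<otimes> p) \<otimes> ((q \<otimes> q) \<otimes> (q \<otimes> q)) = (p \<otimes> q) \<otimes> (p \<otimes> q) \<otimes> (q \<otimes> q)"
    by (simp add: m_ac)
  ultimately have "q \<otimes> q = \<one>" by (simp add: pq)
  then have "q = \<one>" by (rule no_2_torsion[rotated]) simp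
  then show ?thesis using pq by (simp add: p_def)
qed

lemma act_a_fixed':
  assumes [simp]: "x \<in> X" "y \<in> X" "z \<in> X"
  shows "act (a x y z) y = a x y z"
proof -
  have "a z y y = \<one>" "a x z y = a x y z"
    using a_twice[of y z] a_rotate[of y y z] a_comm_right[of x y z] by simp_all
  then show ?thesis
    using act_a_swap[of x z y y] by simp
qed

text \<open>Polarization: \<open>a\<close> vanishes when two arguments agree, so expanding
  \<open>a (x \<cdot> y) (x \<cdot> y) z = \<one>\<close> leaves only the two mixed terms. Both
  equal \<open>a x y z\<close>, because \<open>x\<close> and \<open>y\<close> act trivially on
  it.\<close>

theorem a_trivial:
  assumes [simp]: "x \<in> X" "y \<in> X" "z \<in> X"
  shows "a x y z = \<one>"
proof -
  define r where "r = a x y z"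
  have [simp]: "r \<in> carrier M" by (simp add: r_def)
  have "act r y = r" "act r x = r"
    using act_a_fixed'[of x y z] act_a_fixed'[of y x z] a_comm_left[of x y z] by (simp_all add: r_def)
  moreover have "a (x \<cdot> y) x z = act r x"
    using a_mul[of x y x z] a_comm_left[of y x z] by (simp add: a_twice r_def)
  moreover have "a (x \<cdot> y) y z = r"
    using a_mul[of x y y z] by (simp add: a_twice r_def)
  moreover have "a (x \<cdot> y) (x \<cdot> y) z = a (x \<cdot> y) x z \<otimes> act (a (x \<cdot> y) y z) x"
    using a_mul[of x y "x \<cdot> y" z] a_comm_left[of x "x \<cdot> y" z] a_comm_left[of y "x \<cdot> y" z] by simp
  ultimately have "r \<otimes> r = \<one>" by (simp add: a_twice)
  then show ?thesis unfolding r_def[symmetric] by (rule no_2_torsion[rotated]) simp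
qed

end

section \<open>Groups of permutations and autotopisms of loops\<close>

text \<open>For bijective generators this is the subgroup generated by \<open>S\<close> among the
  permutations of the whole type. Words grow on the left by one generator or inverse, so induction
  treats one letter at a time.\<close>

inductive_set perm_span :: "('a \<Rightarrow> 'a) set \<Rightarrow> ('a \<Rightarrow> 'a) set" for S where
  id: "id \<in> perm_span S"
| comp: "s \<in> S \<Longrightarrow> P \<in> perm_span S \<Longrightarrow> s \<circ> P \<in> perm_span S"
| comp_inv: "s \<in> S \<Longrightarrow> P \<in> perm_span S \<Longrightarrow> inv_into UNIV s \<circ> P \<in> perm_span S"

lemma perm_span_base: "s \<in> S \<Longrightarrow> s \<in> perm_span S"
  using perm_span.comp[OF _ perm_span.id] by fastforce

lemma perm_span_base_inv: "s \<in> S \<Longrightarrow> inv_into UNIV s \<in> perm_span S"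
  using perm_span.comp_inv[OF _ perm_span.id] by fastforce

lemma perm_span_comp:
  assumes "P \<in> perm_span S" "P' \<in> perm_span S"
  shows "P \<circ> P' \<in> perm_span S"
  using assms by induction (simp_all add: comp_assoc perm_span.intros)

lemma perm_span_bij:
  assumes "P \<in> perm_span S" "\<And>s. s \<in> S \<Longrightarrow> bij s"
  shows "bij P"
  using assms(1) by induction (simp_all only: bij_id bij_comp bij_imp_bij_inv assms(2))

lemma perm_span_inv:
  assumes "P \<in> perm_span S" "\<And>s. s \<in> S \<Longrightarrow> bij s"
  shows "inv_into UNIV P \<in> perm_span S"
  using assms(1)
proof induction
  case id
  then show ?case by (simp only: inv_id perm_span.id)
next
  case (comp s P)
  then show ?case
    using perm_span_bij[OF comp(2) assms(2)] assms(2)[OF comp(1)]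
    by (simp only: o_inv_distrib perm_span_base_inv perm_span_comp)
next
  case (comp_inv s P)
  then show ?case
    using perm_span_bij[OF comp_inv(2) assms(2)] assms(2)[OF comp_inv(1)]
    by (simp only: o_inv_distrib bij_imp_bij_inv inv_inv_eq perm_span_base perm_span_comp)
qed

lemma inv_semiconj:
  assumes "bij s" "bij P" "s \<circ> K = K \<circ> P"
  shows "inv_into UNIV s \<circ> K = K \<circ> inv_into UNIV P"
proof
  fix u
  have "s (K (inv_into UNIV P u)) = K u"
    using assms(2) fun_cong[OF assms(3), of "inv_into UNIV P u"]
    by (simp add: bij_is_surj surj_f_inv_f)
  then show "(inv_into UNIV s \<circ> K) u = (K \<circ> inv_into UNIV P) u"
    using assms(1) by (metis bij_is_inj comp_apply inv_f_f)
qed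

text \<open>When \<open>K\<close> is invertible, this says that conjugation by \<open>K\<close> maps
  the generated group into itself as soon as it does so on generators. The form
  \<open>P \<circ> K = K \<circ> P'\<close> avoids writing the inverse of \<open>K\<close>.\<close>

lemma perm_span_semiconj:
  assumes "P \<in> perm_span S" and bij: "\<And>s. s \<in> S \<Longrightarrow> bij s"
    and S: "\<And>s. s \<in> S \<Longrightarrow> \<exists>P' \<in> perm_span S. s \<circ> K = K \<circ> P'"
  shows "\<exists>P' \<in> perm_span S. P \<circ> K = K \<circ> P'"
  using assms(1)
proof induction
  case id
  show ?case by (rule bexI[of _ id]) (simp_all add: perm_span.id del: id_apply)
next
  case (comp s P)
  then obtain P' where P': "P' \<in> perm_span S" "P \<circ> K = K \<circ> P'" by blast
  obtain s' where s': "s' \<in> perm_span S" "s \<circ> K = K \<circ> s'" using S comp by blast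
  have "s \<circ> P \<circ> K = K \<circ> (s' \<circ> P')" using P' s' by (metis comp_assoc)
  then show ?case using P' s' perm_span_comp by blast
next
  case (comp_inv s P)
  then obtain P' where P': "P' \<in> perm_span S" "P \<circ> K = K \<circ> P'" by blast
  obtain s' where s': "s' \<in> perm_span S" "s \<circ> K = K \<circ> s'" using S comp_inv by blast
  have "inv_into UNIV s \<circ> K = K \<circ> inv_into UNIV s'"
    using inv_semiconj s' perm_span_bij bij comp_inv(1) by metis
  then have "inv_into UNIV s \<circ> P \<circ> K = K \<circ> (inv_into UNIV s' \<circ> P')"
    using P' by (metis comp_assoc)
  moreover have "inv_into UNIV s' \<in> perm_span S" using s' perm_span_inv bij by blast
  ultimately show ?case using P' perm_span_comp by blast
qed

lemma perm_span_commute: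
  assumes "P \<in> perm_span S" and bij: "\<And>s. s \<in> S \<Longrightarrow> bij s"
    and S: "\<And>s. s \<in> S \<Longrightarrow> s \<circ> K = K \<circ> s"
  shows "P \<circ> K = K \<circ> P"
  using assms(1)
proof induction
  case id
  then show ?case by simp
next
  case (comp s P)
  then show ?case using S by (metis comp_assoc)
next
  case (comp_inv s P)
  then have "inv_into UNIV s \<circ> K = K \<circ> inv_into UNIV s" using inv_semiconj bij S by metis
  then show ?case using comp_inv by (metis comp_assoc)
qed

section \<open>Divisions, translations and multiplication groups of a loop\<close>

context loop
begin

declare m_closed [simp] one_closed [simp] l_one [simp] r_one [simp]

definition ldiv :: "'a \<Rightarrow> 'a \<Rightarrow> 'a"
  where "ldiv x y = (THE u. u \<in> carrier Q \<and> x \<otimes> u = y)"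

definition rdiv :: "'a \<Rightarrow> 'a \<Rightarrow> 'a"
  where "rdiv y x = (THE v. v \<in> carrier Q \<and> v \<otimes> x = y)"

lemma
  assumes "x \<in> carrier Q" "y \<in> carrier Q"
  shows ldiv_closed [simp]: "ldiv x y \<in> carrier Q" and mult_ldiv [simp]: "x \<otimes> ldiv x y = y"
  using theI'[OF l_division[OF assms]] by (simp_all add: ldiv_def)

lemma
  assumes "x \<in> carrier Q" "y \<in> carrier Q"
  shows rdiv_closed [simp]: "rdiv y x \<in> carrier Q" and rdiv_mult [simp]: "rdiv y x \<otimes> x = y"
  using theI'[OF r_division[OF assms]] by (simp_all add: rdiv_def)

lemma l_cancel [simp]:
  assumes "x \<in> carrier Q" "u \<in> carrier Q" "v \<in> carrier Q"
  shows "x \<otimes> u = x \<otimes> v \<longleftrightarrow> u = v"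
  using l_division[of x "x \<otimes> v"] assms by auto

lemma r_cancel [simp]:
  assumes "x \<in> carrier Q" "u \<in> carrier Q" "v \<in> carrier Q"
  shows "u \<otimes> x = v \<otimes> x \<longleftrightarrow> u = v"
  using r_division[of x "v \<otimes> x"] assms by auto

lemma ldiv_mult [simp]: "x \<in> carrier Q \<Longrightarrow> u \<in> carrier Q \<Longrightarrow> ldiv x (x \<otimes> u) = u"
  using l_cancel[of x "ldiv x (x \<otimes> u)" u] by simp

lemma mult_rdiv [simp]: "x \<in> carrier Q \<Longrightarrow> u \<in> carrier Q \<Longrightarrow> rdiv (u \<otimes> x) x = u"
  using r_cancel[of x "rdiv (u \<otimes> x) x" u] by simp

text \<open>Translations are extended by the identity outside the carrier. They thereby become
  permutations of the whole type, with ordinary composition and \<open>inv_into UNIV\<close> as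
  group operations.\<close>

definition L :: "'a \<Rightarrow> 'a \<Rightarrow> 'a"
  where "L x u = (if u \<in> carrier Q then x \<otimes> u else u)"

definition R :: "'a \<Rightarrow> 'a \<Rightarrow> 'a"
  where "R x u = (if u \<in> carrier Q then u \<otimes> x else u)"

definition perms :: "('a \<Rightarrow> 'a) set"
  where "perms = {P. bij P \<and> (\<forall>u. P u \<in> carrier Q \<longleftrightarrow> u \<in> carrier Q)}"

lemma perms_bij: "P \<in> perms \<Longrightarrow> bij P"
  by (simp add: perms_def)

lemma perms_iff: "P \<in> perms \<Longrightarrow> P u \<in> carrier Q \<longleftrightarrow> u \<in> carrier Q"
  by (simp add: perms_def)

lemma inv_perms [simp]: "P \<in> perms \<Longrightarrow> inv_into UNIV P (P u) = u"
  by (rule inv_f_f) (rule bij_is_inj[OF perms_bij])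

lemma perms_id [simp]: "id \<in> perms"
  by (simp add: perms_def)

lemma perms_comp [simp]: "P \<in> perms \<Longrightarrow> P' \<in> perms \<Longrightarrow> P \<circ> P' \<in> perms"
  by (simp add: perms_def bij_comp)

lemma perms_inv [simp]:
  assumes "P \<in> perms"
  shows "inv_into UNIV P \<in> perms"
proof -
  have "inv_into UNIV P u \<in> carrier Q \<longleftrightarrow> u \<in> carrier Q" for u
    using perms_iff[OF assms, of "inv_into UNIV P u"] perms_bij[OF assms]
    by (simp only: bij_is_surj surj_f_inv_f)
  then show ?thesis using perms_bij[OF assms] unfolding perms_def by (blast intro: bij_imp_bij_inv)
qed

lemma perms_surjE:
  assumes "P \<in> perms" "u \<in> carrier Q"
  obtains v where "v \<in> carrier Q" "P v = u"
  using assms by (metis bij_pointE perms_bij perms_iff)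

lemma inv_L:
  assumes "x \<in> carrier Q"
  shows "bij (L x)" and "inv_into UNIV (L x) = (\<lambda>u. if u \<in> carrier Q then ldiv x u else u)"
proof -
  show "bij (L x)"
    by (rule o_bij[of "\<lambda>u. if u \<in> carrier Q then ldiv x u else u"]) (use assms in \<open>auto simp: L_def fun_eq_iff\<close>)
  show "inv_into UNIV (L x) = (\<lambda>u. if u \<in> carrier Q then ldiv x u else u)"
    by (rule inv_unique_comp) (use assms in \<open>auto simp: L_def fun_eq_iff\<close>)
qed

lemma inv_R:
  assumes "x \<in> carrier Q"
  shows "bij (R x)" and "inv_into UNIV (R x) = (\<lambda>u. if u \<in> carrier Q then rdiv u x else u)"
proof -
  show "bij (R x)"
    by (rule o_bij[of "\<lambda>u. if u \<in> carrier Q then rdiv u x else u"]) (use assms in \<open>auto simp: R_def fun_eq_iff\<close>)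
  show "inv_into UNIV (R x) = (\<lambda>u. if u \<in> carrier Q then rdiv u x else u)"
    by (rule inv_unique_comp) (use assms in \<open>auto simp: R_def fun_eq_iff\<close>)
qed

lemma L_perm [simp]: "x \<in> carrier Q \<Longrightarrow> L x \<in> perms"
  unfolding perms_def by (simp add: inv_L(1)) (simp add: L_def)

lemma R_perm [simp]: "x \<in> carrier Q \<Longrightarrow> R x \<in> perms"
  unfolding perms_def by (simp add: inv_R(1)) (simp add: R_def)

lemma L_apply [simp]: "u \<in> carrier Q \<Longrightarrow> L x u = x \<otimes> u"
  by (simp add: L_def)

lemma R_apply [simp]: "u \<in> carrier Q \<Longrightarrow> R x u = u \<otimes> x"
  by (simp add: R_def)

lemma inv_L_apply [simp]:
  "x \<in> carrier Q \<Longrightarrow> u \<in> carrier Q \<Longrightarrow> inv_into UNIV (L x) u = ldiv x u"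
  by (simp add: inv_L)

lemma inv_R_apply [simp]:
  "x \<in> carrier Q \<Longrightarrow> u \<in> carrier Q \<Longrightarrow> inv_into UNIV (R x) u = rdiv u x"
  by (simp add: inv_R)

abbreviation LMlt :: "('a \<Rightarrow> 'a) set"
  where "LMlt \<equiv> perm_span (L ` carrier Q)"

abbreviation RMlt :: "('a \<Rightarrow> 'a) set"
  where "RMlt \<equiv> perm_span (R ` carrier Q)"

lemma L_in_LMlt [simp]: "x \<in> carrier Q \<Longrightarrow> L x \<in> LMlt"
  "x \<in> carrier Q \<Longrightarrow> inv_into UNIV (L x) \<in> LMlt"
  by (auto intro: perm_span_base perm_span_base_inv)

lemma R_in_RMlt [simp]: "x \<in> carrier Q \<Longrightarrow> R x \<in> RMlt"
  "x \<in> carrier Q \<Longrightarrow> inv_into UNIV (R x) \<in> RMlt"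
  by (auto intro: perm_span_base perm_span_base_inv)

section \<open>Autotopisms\<close>

definition autotopism :: "('a \<Rightarrow> 'a) \<Rightarrow> ('a \<Rightarrow> 'a) \<Rightarrow> ('a \<Rightarrow> 'a) \<Rightarrow> bool"
  where "autotopism A B C \<longleftrightarrow> A \<in> perms \<and> B \<in> perms \<and> C \<in> perms \<and>
    (\<forall>u \<in> carrier Q. \<forall>v \<in> carrier Q. A u \<otimes> B v = C (u \<otimes> v))"

lemma autotopism_comp:
  "autotopism A B C \<Longrightarrow> autotopism A' B' C' \<Longrightarrow> autotopism (A \<circ> A') (B \<circ> B') (C \<circ> C')"
  unfolding autotopism_def by (auto simp: perms_iff[of A'] perms_iff[of B'])

lemma autotopism_inv:
  assumes "autotopism A B C"
  shows "autotopism (inv_into UNIV A) (inv_into UNIV B) (inv_into UNIV C)"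
proof -
  have perms: "A \<in> perms" "B \<in> perms" "C \<in> perms" using assms by (auto simp: autotopism_def)
  have "inv_into UNIV A u \<otimes> inv_into UNIV B v = inv_into UNIV C (u \<otimes> v)"
    if u: "u \<in> carrier Q" and v: "v \<in> carrier Q" for u v
  proof -
    obtain u' where u': "u' \<in> carrier Q" "A u' = u" using perms_surjE[OF perms(1) u] .
    obtain v' where v': "v' \<in> carrier Q" "B v' = v" using perms_surjE[OF perms(2) v] .
    have uv: "C (u' \<otimes> v') = u \<otimes> v" using assms u' v' by (auto simp: autotopism_def)
    have "inv_into UNIV A u = u'" "inv_into UNIV B v = v'"
      using perms by (simp_all only: inv_perms flip: u'(2) v'(2))
    moreover have "inv_into UNIV C (u \<otimes> v) = u' \<otimes> v'"
      using perms(3) by (simp only: inv_perms flip: uv)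
    ultimately show ?thesis by (simp only:)
  qed
  then show ?thesis using perms by (simp add: autotopism_def)
qed

section \<open>The nucleus and its translations\<close>

definition nucleus :: "'a set"
  where "nucleus = {n \<in> carrier Q. \<forall>u \<in> carrier Q. \<forall>v \<in> carrier Q.
    n \<otimes> u \<otimes> v = n \<otimes> (u \<otimes> v) \<and> u \<otimes> n \<otimes> v = u \<otimes> (n \<otimes> v) \<and> u \<otimes> v \<otimes> n = u \<otimes> (v \<otimes> n)}"

lemma nucleus_closed [simp]: "n \<in> nucleus \<Longrightarrow> n \<in> carrier Q"
  by (simp add: nucleus_def)

lemma
  assumes "n \<in> nucleus" "u \<in> carrier Q" "v \<in> carrier Q"
  shows nucleus_left: "n \<otimes> u \<otimes> v = n \<otimes> (u \<otimes> v)"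
    and nucleus_middle: "u \<otimes> n \<otimes> v = u \<otimes> (n \<otimes> v)"
    and nucleus_right: "u \<otimes> v \<otimes> n = u \<otimes> (v \<otimes> n)"
  using assms unfolding nucleus_def by blast+

lemma one_in_nucleus [simp]: "\<one> \<in> nucleus"
  by (simp add: nucleus_def del: nucleus_closed)

lemma nucleus_mult [simp]:
  assumes "m \<in> nucleus" "n \<in> nucleus"
  shows "m \<otimes> n \<in> nucleus"
proof -
  have [simp]: "m \<in> carrier Q" "n \<in> carrier Q" using assms by simp_all
  show ?thesis
    unfolding nucleus_def
  proof (intro CollectI conjI ballI)
    fix u v assume uv [simp]: "u \<in> carrier Q" "v \<in> carrier Q"
    show "m \<otimes> n \<otimes> u \<otimes> v = m \<otimes> n \<otimes> (u \<otimes> v)"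
    proof -
      have "m \<otimes> n \<otimes> u \<otimes> v = m \<otimes> (n \<otimes> u) \<otimes> v" using assms by (simp add: nucleus_left[of m n u])
      also have "\<dots> = m \<otimes> (n \<otimes> u \<otimes> v)" using assms by (intro nucleus_left) simp_all
      also have "n \<otimes> u \<otimes> v = n \<otimes> (u \<otimes> v)" using assms by (intro nucleus_left) simp_all
      also have "m \<otimes> (n \<otimes> (u \<otimes> v)) = m \<otimes> n \<otimes> (u \<otimes> v)" using assms by (intro nucleus_left[symmetric]) simp_all
      finally show ?thesis .
    qed
    show "u \<otimes> (m \<otimes> n) \<otimes> v = u \<otimes> (m \<otimes> n \<otimes> v)"
    proof -
      have "u \<otimes> (m \<otimes> n) \<otimes> v = u \<otimes> m \<otimes> n \<otimes> v" using assms by (simp add: nucleus_right[of n u m])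
      also have "\<dots> = u \<otimes> m \<otimes> (n \<otimes> v)" using assms by (intro nucleus_middle) simp_all
      also have "\<dots> = u \<otimes> (m \<otimes> (n \<otimes> v))" using assms by (intro nucleus_middle) simp_all
      also have "m \<otimes> (n \<otimes> v) = m \<otimes> n \<otimes> v" using assms by (intro nucleus_left[symmetric]) simp_all
      finally show ?thesis .
    qed
    show "u \<otimes> v \<otimes> (m \<otimes> n) = u \<otimes> (v \<otimes> (m \<otimes> n))"
    proof -
      have "u \<otimes> v \<otimes> (m \<otimes> n) = u \<otimes> v \<otimes> m \<otimes> n" using assms by (intro nucleus_right[symmetric]) simp_all
      also have "u \<otimes> v \<otimes> m = u \<otimes> (v \<otimes> m)" using assms by (intro nucleus_right) simp_all
      also have "u \<otimes> (v \<otimes> m) \<otimes> n = u \<otimes> (v \<otimes> m \<otimes> n)" using assms by (intro nucleus_right) simp_all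
      also have "v \<otimes> m \<otimes> n = v \<otimes> (m \<otimes> n)" using assms by (intro nucleus_right) simp_all
      finally show ?thesis .
    qed
  qed simp
qed

lemma nucleus_inverse:
  assumes n: "n \<in> nucleus"
  obtains n' where "n' \<in> nucleus" "n' \<otimes> n = \<one>" "n \<otimes> n' = \<one>"
proof -
  define n' where "n' = ldiv n \<one>"
  have [simp]: "n \<in> carrier Q" "n' \<in> carrier Q" "n \<otimes> n' = \<one>" using n by (simp_all add: n'_def)
  have "n \<otimes> (n' \<otimes> n) = n \<otimes> \<one>" using nucleus_left[OF n, of n' n] by simp
  then have [simp]: "n' \<otimes> n = \<one>" by (subst (asm) l_cancel) simp_all
  have n'n: "u \<otimes> n' \<otimes> n = u" if "u \<in> carrier Q" for u using nucleus_right[OF n that, of n'] that by simp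
  have nn': "n \<otimes> (n' \<otimes> u) = u" if "u \<in> carrier Q" for u using nucleus_left[OF n _ that, of n'] that by simp
  have "n' \<in> nucleus"
    unfolding nucleus_def
  proof (intro CollectI conjI ballI)
    fix u v assume uv [simp]: "u \<in> carrier Q" "v \<in> carrier Q"
    have "n \<otimes> (n' \<otimes> u \<otimes> v) = n \<otimes> (n' \<otimes> (u \<otimes> v))"
      using nucleus_left[OF n, of "n' \<otimes> u" v] by (simp add: nn')
    then show "n' \<otimes> u \<otimes> v = n' \<otimes> (u \<otimes> v)" by simp
    have "u \<otimes> v \<otimes> n' \<otimes> n = u \<otimes> (v \<otimes> n') \<otimes> n"
      using nucleus_right[OF n, of u "v \<otimes> n'"] by (simp add: n'n)
    then show "u \<otimes> v \<otimes> n' = u \<otimes> (v \<otimes> n')" by simp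
    have "u \<otimes> n' \<otimes> v = u \<otimes> n' \<otimes> (n \<otimes> (n' \<otimes> v))" by (simp add: nn')
    also have "\<dots> = u \<otimes> (n' \<otimes> v)" using nucleus_middle[OF n, of "u \<otimes> n'" "n' \<otimes> v"] by (simp add: n'n)
    finally show "u \<otimes> n' \<otimes> v = u \<otimes> (n' \<otimes> v)" .
  qed simp
  then show ?thesis using that by simp
qed

text \<open>The law \<open>u (v n) = (u v) n\<close> says exactly that \<open>R n\<close> commutes
  with each generator \<open>L u\<close>.\<close>

lemma R_nucleus_LMlt:
  assumes "P \<in> LMlt" and n: "n \<in> nucleus"
  shows "P \<circ> R n = R n \<circ> P"
proof (rule perm_span_commute[OF assms(1)])
  show "s \<circ> R n = R n \<circ> s" if "s \<in> L ` carrier Q" for s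
    using that n by (auto simp: fun_eq_iff L_def R_def nucleus_right)
qed (auto intro: inv_L)

lemma L_nucleus_RMlt:
  assumes "P \<in> RMlt" and n: "n \<in> nucleus"
  shows "P \<circ> L n = L n \<circ> P"
proof (rule perm_span_commute[OF assms(1)])
  show "s \<circ> L n = L n \<circ> s" if "s \<in> R ` carrier Q" for s
    using that n by (auto simp: fun_eq_iff L_def R_def nucleus_left)
qed (auto intro: inv_R)

end

section \<open>Nucleus and associators of conjugacy closed loops\<close>

context cc_loop
begin

section \<open>Conjugacy closedness in terms of translations\<close>

text \<open>Putting \<open>z = \<one>\<close> in the axiom determines the witness
  \<open>f(x,y)\<close> as the unique \<open>f\<close> with
  \<open>f \<otimes> x = x \<otimes> y\<close>, so the axiom can be used without the witness
  functions.\<close>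

lemma left_conjugacy_closed:
  assumes [simp]: "x \<in> carrier Q" "y \<in> carrier Q" "z \<in> carrier Q" "f \<in> carrier Q"
    and f: "f \<otimes> x = x \<otimes> y"
  shows "f \<otimes> (x \<otimes> z) = x \<otimes> (y \<otimes> z)"
proof -
  obtain F where F: "F \<in> carrier Q \<rightarrow> carrier Q \<rightarrow> carrier Q"
    and eq: "\<And>t. t \<in> carrier Q \<Longrightarrow> x \<otimes> (y \<otimes> t) = F x y \<otimes> (x \<otimes> t)"
    using conjugacy_closed assms(1,2) by blast
  have "F x y \<in> carrier Q" using F assms(1,2) by blast
  moreover have "F x y \<otimes> x = f \<otimes> x" using eq[of \<one>] f by simp
  ultimately have "F x y = f" by (subst (asm) r_cancel) simp_all
  then show ?thesis using eq by simp
qed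

lemma right_conjugacy_closed:
  assumes [simp]: "x \<in> carrier Q" "y \<in> carrier Q" "z \<in> carrier Q" "g \<in> carrier Q"
    and g: "x \<otimes> g = y \<otimes> x"
  shows "z \<otimes> x \<otimes> g = z \<otimes> y \<otimes> x"
proof -
  obtain G where G: "G \<in> carrier Q \<rightarrow> carrier Q \<rightarrow> carrier Q"
    and eq: "\<And>t. t \<in> carrier Q \<Longrightarrow> t \<otimes> y \<otimes> x = t \<otimes> x \<otimes> G x y"
    using conjugacy_closed assms(1,2) by blast
  have "G x y \<in> carrier Q" using G assms(1,2) by blast
  moreover have "x \<otimes> G x y = x \<otimes> g" using eq[of \<one>] g by simp
  ultimately have "G x y = g" by (subst (asm) l_cancel) simp_all
  then show ?thesis using eq by simp
qed

text \<open>The right conjugacy law read as an equation of permutations: conjugating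
  \<open>L v\<close> by \<open>R x\<close> gives \<open>L (v \<otimes> x)\<close> after the inverse
  of \<open>L x\<close>.\<close>

lemma R_comp_L:
  assumes [simp]: "x \<in> carrier Q" "v \<in> carrier Q"
  shows "R x \<circ> L v = L (v \<otimes> x) \<circ> (inv_into UNIV (L x) \<circ> R x)"
proof
  fix u
  show "(R x \<circ> L v) u = (L (v \<otimes> x) \<circ> (inv_into UNIV (L x) \<circ> R x)) u"
  proof (cases "u \<in> carrier Q")
    case True
    then show ?thesis using right_conjugacy_closed[of x u v "ldiv x (u \<otimes> x)"] by simp
  next
    case False
    then show ?thesis by (simp add: L_def R_def inv_L)
  qed
qed

lemma autotopism_L:
  "x \<in> carrier Q \<Longrightarrow> autotopism (inv_into UNIV (R x) \<circ> L x) (L x) (L x)"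
  unfolding autotopism_def by (simp add: left_conjugacy_closed)

lemma autotopism_R:
  "x \<in> carrier Q \<Longrightarrow> autotopism (R x) (inv_into UNIV (L x) \<circ> R x) (R x)"
  unfolding autotopism_def by (simp add: right_conjugacy_closed)

lemma autotopism_LMlt:
  assumes "P \<in> LMlt"
  obtains A where "autotopism A P P"
proof -
  have "\<exists>A. autotopism A P P"
    using assms
  proof induction
    case id
    have "autotopism id id id" by (simp add: autotopism_def)
    then show ?case by blast
  next
    case (comp s P)
    then obtain x A where "x \<in> carrier Q" "s = L x" "autotopism A P P" by blast
    then show ?case using autotopism_comp[OF autotopism_L] by blast
  next
    case (comp_inv s P)
    then obtain x A where "x \<in> carrier Q" "s = L x" "autotopism A P P" by blast
    then show ?case using autotopism_comp[OF autotopism_inv[OF autotopism_L]] by blast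
  qed
  then show ?thesis using that by blast
qed

lemma autotopism_RMlt:
  assumes "P \<in> RMlt"
  obtains B where "autotopism P B P"
proof -
  have "\<exists>B. autotopism P B P"
    using assms
  proof induction
    case id
    have "autotopism id id id" by (simp add: autotopism_def)
    then show ?case by blast
  next
    case (comp s P)
    then obtain x A where "x \<in> carrier Q" "s = R x" "autotopism P A P" by blast
    then show ?case using autotopism_comp[OF autotopism_R] by blast
  next
    case (comp_inv s P)
    then obtain x A where "x \<in> carrier Q" "s = R x" "autotopism P A P" by blast
    then show ?case using autotopism_comp[OF autotopism_inv[OF autotopism_R]] by blast
  qed
  then show ?thesis using that by blast
qed

text \<open>Conjugation by left translations preserves the right multiplication group; it suffices
  to exhibit the conjugate of each \<open>R v\<close>.\<close>

lemma RMlt_semiconj_L: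
  assumes "P \<in> RMlt" and x [simp]: "x \<in> carrier Q"
  obtains P' where "P' \<in> RMlt" "P \<circ> L x = L x \<circ> P'"
proof -
  have "\<exists>P' \<in> RMlt. P \<circ> L x = L x \<circ> P'"
  proof (rule perm_span_semiconj[OF assms(1)])
    fix s assume "s \<in> R ` carrier Q"
    then obtain v where v [simp]: "v \<in> carrier Q" and s: "s = R v" by blast
    define w w0 where "w = ldiv x v" and "w0 = ldiv x \<one>"
    have w [simp]: "w \<in> carrier Q" "w0 \<in> carrier Q" "x \<otimes> w = v" "x \<otimes> w0 = \<one>"
      by (simp_all add: w_def w0_def)
    have "(R v \<circ> L x) u = (L x \<circ> (R w \<circ> inv_into UNIV (R w0))) u" for u
    proof (cases "u \<in> carrier Q")
      case [simp]: True
      \<comment> \<open>Left conjugacy closedness gives \<open>f (x s) = x (t s)\<close> for every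
        \<open>s\<close>. The choice \<open>s = w0\<close> identifies \<open>f\<close> as
        \<open>x u\<close>, and \<open>s = w\<close> then computes \<open>(x u) v\<close>.\<close>
      define t f where "t = rdiv u w0" and "f = rdiv (x \<otimes> t) x"
      have [simp]: "t \<in> carrier Q" "f \<in> carrier Q" "t \<otimes> w0 = u" "f \<otimes> x = x \<otimes> t"
        by (simp_all add: t_def f_def)
      have "f = x \<otimes> u" using left_conjugacy_closed[of x t w0 f] by simp
      moreover have "f \<otimes> v = x \<otimes> (t \<otimes> w)" using left_conjugacy_closed[of x t w f] by simp
      ultimately have "x \<otimes> u \<otimes> v = x \<otimes> (t \<otimes> w)" by simp
      then show ?thesis by (simp flip: t_def)
    next
      case False
      then show ?thesis by (simp add: L_def R_def inv_R)
    qed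
    then have "R v \<circ> L x = L x \<circ> (R w \<circ> inv_into UNIV (R w0))" by blast
    moreover have "R w \<circ> inv_into UNIV (R w0) \<in> RMlt" by (intro perm_span_comp R_in_RMlt w)
    ultimately show "\<exists>P' \<in> RMlt. s \<circ> L x = L x \<circ> P'" using s by blast
  qed (auto intro: inv_R)
  then show ?thesis using that by blast
qed

text \<open>Mirror image of \<open>RMlt_semiconj_L\<close>, based on the right conjugacy
  law.\<close>

lemma LMlt_semiconj_R:
  assumes "P \<in> LMlt" and x [simp]: "x \<in> carrier Q"
  obtains P' where "P' \<in> LMlt" "P \<circ> R x = R x \<circ> P'"
proof -
  have "\<exists>P' \<in> LMlt. P \<circ> R x = R x \<circ> P'"
  proof (rule perm_span_semiconj[OF assms(1)])
    fix s assume "s \<in> L ` carrier Q"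
    then obtain v where v [simp]: "v \<in> carrier Q" and s: "s = L v" by blast
    define w w0 where "w = rdiv v x" and "w0 = rdiv \<one> x"
    have w [simp]: "w \<in> carrier Q" "w0 \<in> carrier Q" "w \<otimes> x = v" "w0 \<otimes> x = \<one>"
      by (simp_all add: w_def w0_def)
    have "(L v \<circ> R x) u = (R x \<circ> (L w \<circ> inv_into UNIV (L w0))) u" for u
    proof (cases "u \<in> carrier Q")
      case [simp]: True
      define t g where "t = ldiv w0 u" and "g = ldiv x (t \<otimes> x)"
      have [simp]: "t \<in> carrier Q" "g \<in> carrier Q" "w0 \<otimes> t = u" "x \<otimes> g = t \<otimes> x"
        by (simp_all add: t_def g_def)
      have "g = u \<otimes> x" using right_conjugacy_closed[of x t w0 g] by simp
      moreover have "v \<otimes> g = w \<otimes> t \<otimes> x" using right_conjugacy_closed[of x t w g] by simp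
      ultimately have "v \<otimes> (u \<otimes> x) = w \<otimes> t \<otimes> x" by simp
      then show ?thesis by (simp flip: t_def)
    next
      case False
      then show ?thesis by (simp add: L_def R_def inv_L)
    qed
    then have "L v \<circ> R x = R x \<circ> (L w \<circ> inv_into UNIV (L w0))" by blast
    moreover have "L w \<circ> inv_into UNIV (L w0) \<in> LMlt" by (intro perm_span_comp L_in_LMlt w)
    ultimately show "\<exists>P' \<in> LMlt. s \<circ> R x = R x \<circ> P'" using s by blast
  qed (auto intro: inv_L)
  then show ?thesis using that by blast
qed

section \<open>Coincidence of the left, middle and right nuclei\<close>

text \<open>If \<open>f n = n u\<close>, conjugacy closedness gives
  \<open>f (n v) = n (u v)\<close>, while middle nuclearity gives
  \<open>f (n v) = (f n) v = (n u) v\<close>. The right law follows dually.\<close>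

lemma middle_nuclearI:
  assumes [simp]: "n \<in> carrier Q"
    and mid: "\<And>u v. u \<in> carrier Q \<Longrightarrow> v \<in> carrier Q \<Longrightarrow> u \<otimes> n \<otimes> v = u \<otimes> (n \<otimes> v)"
  shows "n \<in> nucleus"
  unfolding nucleus_def
proof (intro CollectI conjI ballI)
  fix u v assume [simp]: "u \<in> carrier Q" "v \<in> carrier Q"
  show "n \<otimes> u \<otimes> v = n \<otimes> (u \<otimes> v)"
    using left_conjugacy_closed[of n u v "rdiv (n \<otimes> u) n"] mid[of "rdiv (n \<otimes> u) n" v] by simp
  show "u \<otimes> v \<otimes> n = u \<otimes> (v \<otimes> n)"
    using right_conjugacy_closed[of n v u "ldiv n (v \<otimes> n)"] mid[of u "ldiv n (v \<otimes> n)"] by simp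
qed (simp_all add: mid)

lemma right_nuclearI:
  assumes [simp]: "n \<in> carrier Q"
    and right: "\<And>u v. u \<in> carrier Q \<Longrightarrow> v \<in> carrier Q \<Longrightarrow> u \<otimes> v \<otimes> n = u \<otimes> (v \<otimes> n)"
  shows "n \<in> nucleus"
proof (rule middle_nuclearI)
  fix u v assume [simp]: "u \<in> carrier Q" "v \<in> carrier Q"
  show "u \<otimes> n \<otimes> v = u \<otimes> (n \<otimes> v)"
    using right_conjugacy_closed[of n "rdiv (n \<otimes> v) n" u v] right[of u "rdiv (n \<otimes> v) n"] by simp
qed simp

lemma left_nuclearI:
  assumes [simp]: "n \<in> carrier Q"
    and left: "\<And>u v. u \<in> carrier Q \<Longrightarrow> v \<in> carrier Q \<Longrightarrow> n \<otimes> u \<otimes> v = n \<otimes> (u \<otimes> v)"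
  shows "n \<in> nucleus"
proof (rule middle_nuclearI)
  fix u v assume [simp]: "u \<in> carrier Q" "v \<in> carrier Q"
  show "u \<otimes> n \<otimes> v = u \<otimes> (n \<otimes> v)"
    using left_conjugacy_closed[of n "ldiv n (u \<otimes> n)" v u] left[of "ldiv n (u \<otimes> n)" v] by simp
qed simp

section \<open>Comparison of autotopisms and centrality of associators\<close>

text \<open>Equality of the third components means
  \<open>A u \<otimes> B v = A' u \<otimes> B' v\<close>. Preimages of \<open>\<one>\<close> under
  \<open>A\<close> and \<open>B'\<close> yield \<open>B = n B'\<close> and \<open>A' = A n\<close>
  with one and the same \<open>n\<close>; substituting back shows that \<open>n\<close> is middle
  nuclear, since \<open>A\<close> and \<open>B'\<close> are onto.\<close>

lemma autotopisms_same_third: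
  assumes ABC: "autotopism A B C" and ABC': "autotopism A' B' C"
  obtains n where "n \<in> nucleus" "\<And>v. v \<in> carrier Q \<Longrightarrow> B v = n \<otimes> B' v"
proof -
  have perms: "A \<in> perms" "B \<in> perms" "A' \<in> perms" "B' \<in> perms"
    using assms by (auto simp: autotopism_def)
  note closed [simp] = perms[THEN perms_iff, THEN iffD2]
  have eq: "A u \<otimes> B v = A' u \<otimes> B' v" if "u \<in> carrier Q" "v \<in> carrier Q" for u v
    using assms that by (simp add: autotopism_def)
  obtain u0 where u0 [simp]: "u0 \<in> carrier Q" "A u0 = \<one>" using perms_surjE[OF perms(1) one_closed] .
  obtain v0 where v0 [simp]: "v0 \<in> carrier Q" "B' v0 = \<one>" using perms_surjE[OF perms(4) one_closed] .
  define n where "n = A' u0"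
  have n [simp]: "n \<in> carrier Q" by (simp add: n_def)
  have B: "B v = n \<otimes> B' v" if "v \<in> carrier Q" for v
    using eq[of u0 v] that by (simp add: n_def)
  have A': "A' u = A u \<otimes> n" if "u \<in> carrier Q" for u
    using eq[of u v0] B[of v0] that by simp
  have "n \<in> nucleus"
  proof (rule middle_nuclearI)
    fix s t assume s: "s \<in> carrier Q" and t: "t \<in> carrier Q"
    obtain u where u: "u \<in> carrier Q" "A u = s" using perms_surjE[OF perms(1) s] .
    obtain v where v: "v \<in> carrier Q" "B' v = t" using perms_surjE[OF perms(4) t] .
    show "s \<otimes> n \<otimes> t = s \<otimes> (n \<otimes> t)"
      using eq[OF u(1) v(1)] by (simp add: A' B u v)
  qed simp
  then show ?thesis using B that by blast
qed

definition nucleus_center :: "'a set"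
  where "nucleus_center = {c \<in> nucleus. \<forall>n \<in> nucleus. c \<otimes> n = n \<otimes> c}"

lemma nucleus_center_nucleus [simp]: "c \<in> nucleus_center \<Longrightarrow> c \<in> nucleus"
  by (simp add: nucleus_center_def)

lemma nucleus_center_comm: "c \<in> nucleus_center \<Longrightarrow> n \<in> nucleus \<Longrightarrow> c \<otimes> n = n \<otimes> c"
  unfolding nucleus_center_def by blast

text \<open>The autotopisms \<open>(A, P, P)\<close> and \<open>(P, B, P)\<close> share their third
  component and \<open>B \<one> = \<one>\<close>, so \<open>P \<one>\<close> is nuclear. As
  \<open>P\<close> commutes with \<open>R m\<close> and \<open>L m\<close> for nuclear
  \<open>m\<close>, computing \<open>P m\<close> in two ways makes \<open>P \<one>\<close> central
  in the nucleus.\<close>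

lemma LMlt_RMlt_one:
  assumes L: "P \<in> LMlt" and R: "P \<in> RMlt"
  shows "P \<one> \<in> nucleus_center"
proof -
  obtain A where A: "autotopism A P P" using autotopism_LMlt[OF L] .
  obtain B where B: "autotopism P B P" using autotopism_RMlt[OF R] .
  obtain n where n: "n \<in> nucleus" and PB: "\<And>v. v \<in> carrier Q \<Longrightarrow> P v = n \<otimes> B v"
    using autotopisms_same_third[OF A B] by blast
  have P1 [simp]: "P \<one> \<in> carrier Q" and B1 [simp]: "B \<one> \<in> carrier Q"
    using B perms_iff[of P] perms_iff[of B] by (simp_all add: autotopism_def)
  have "P \<one> \<otimes> B \<one> = P (\<one> \<otimes> \<one>)" using B by (simp only: autotopism_def one_closed)
  then have "P \<one> \<otimes> B \<one> = P \<one> \<otimes> \<one>" by simp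
  then have "B \<one> = \<one>" by (subst (asm) l_cancel) simp_all
  then have "P \<one> = n" using PB[of \<one>] n by simp
  moreover have "n \<otimes> m = m \<otimes> n" if m: "m \<in> nucleus" for m
    using fun_cong[OF R_nucleus_LMlt[OF L m], of \<one>] fun_cong[OF L_nucleus_RMlt[OF R m], of \<one>] m n
      \<open>P \<one> = n\<close> by simp
  ultimately show ?thesis using n unfolding nucleus_center_def by blast
qed

definition associator :: "'a \<Rightarrow> 'a \<Rightarrow> 'a \<Rightarrow> 'a"
  where "associator x y z = ldiv (x \<otimes> (y \<otimes> z)) (x \<otimes> y \<otimes> z)"

lemma associator:
  assumes "x \<in> carrier Q" "y \<in> carrier Q" "z \<in> carrier Q"
  shows "x \<otimes> y \<otimes> z = x \<otimes> (y \<otimes> z) \<otimes> associator x y z"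
  using assms by (simp add: associator_def)

lemma associator_eqI:
  assumes "x \<in> carrier Q" "y \<in> carrier Q" "z \<in> carrier Q" "c \<in> carrier Q"
    and "x \<otimes> y \<otimes> z = x \<otimes> (y \<otimes> z) \<otimes> c"
  shows "associator x y z = c"
  using assms by (simp add: associator_def)

lemma associator_center [simp]:
  assumes [simp]: "x \<in> carrier Q" "y \<in> carrier Q" "z \<in> carrier Q"
  shows "associator x y z \<in> nucleus_center"
proof -
  \<comment> \<open>This permutation sends \<open>x (y t)\<close> to \<open>(x y) t\<close>. It is
    written here with right translations, and conjugacy closedness also expresses it with left ones,
    so it lies in both multiplication groups.\<close>
  define E where "E = R y \<circ> (R x \<circ> inv_into UNIV (R (x \<otimes> y)))"
  have eq: "E u = x \<otimes> y \<otimes> t"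
    if [simp]: "u \<in> carrier Q" "t \<in> carrier Q" and u: "x \<otimes> (y \<otimes> t) = u" for u t
  proof -
    define r where "r = rdiv u (x \<otimes> y)"
    define s where "s = ldiv x (r \<otimes> x)"
    have [simp]: "r \<in> carrier Q" "s \<in> carrier Q" "r \<otimes> (x \<otimes> y) = u" "x \<otimes> s = r \<otimes> x"
      by (simp_all add: r_def s_def)
    have "x \<otimes> (s \<otimes> y) = x \<otimes> (y \<otimes> t)"
      using left_conjugacy_closed[of x s y r] u by simp
    then have "y \<otimes> t = s \<otimes> y" by simp
    then have "x \<otimes> y \<otimes> t = r \<otimes> x \<otimes> y"
      using right_conjugacy_closed[of y s x t] by simp
    then show ?thesis by (simp add: E_def flip: r_def)
  qed
  have "E = L (x \<otimes> y) \<circ> (inv_into UNIV (L y) \<circ> inv_into UNIV (L x))"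
  proof
    fix u
    show "E u = (L (x \<otimes> y) \<circ> (inv_into UNIV (L y) \<circ> inv_into UNIV (L x))) u"
    proof (cases "u \<in> carrier Q")
      case True
      then show ?thesis using eq[of u "ldiv y (ldiv x u)"] by simp
    next
      case False
      then show ?thesis by (simp add: E_def L_def R_def inv_L inv_R)
    qed
  qed
  then have EL: "E \<in> LMlt" by (simp only:) (intro perm_span_comp L_in_LMlt m_closed assms)
  have ER: "E \<in> RMlt" unfolding E_def by (intro perm_span_comp R_in_RMlt m_closed assms)
  define w where "w = x \<otimes> (y \<otimes> z)"
  have w [simp]: "w \<in> carrier Q" by (simp add: w_def)
  \<comment> \<open>Conjugating by \<open>L w\<close> keeps \<open>E\<close> in both groups and
    moves the base point from \<open>w\<close> to \<open>\<one>\<close>, so the value of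
    \<open>P\<close> at \<open>\<one>\<close> is the associator.\<close>
  obtain P where P: "P \<in> RMlt" "E \<circ> L w = L w \<circ> P" using RMlt_semiconj_L[OF ER w] .
  have "P = inv_into UNIV (L w) \<circ> (E \<circ> L w)" by (simp add: P(2) fun_eq_iff)
  then have "P \<in> LMlt" using EL by (simp only:) (intro perm_span_comp L_in_LMlt w)
  then have "P \<one> \<in> nucleus_center" using LMlt_RMlt_one P(1) by blast
  moreover have "P \<one> = associator x y z"
    using fun_cong[OF \<open>P = _\<close>, of \<one>] eq[of w z] by (simp add: associator_def flip: w_def)
  ultimately show ?thesis by simp
qed

section \<open>Normality of the nucleus and commutativity of the quotient\<close>

text \<open>Right translation by \<open>m = ldiv x (n \<otimes> x)\<close> is the conjugate of
  \<open>R n\<close> by \<open>R x\<close>. Conjugating \<open>L u\<close> back by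
  \<open>R x\<close> stays in the left multiplication group, whose elements commute with
  \<open>R n\<close>; hence \<open>R m\<close> commutes with every \<open>L u\<close>.\<close>

lemma nucleus_normal_right:
  assumes n: "n \<in> nucleus" and x [simp]: "x \<in> carrier Q"
  shows "ldiv x (n \<otimes> x) \<in> nucleus"
proof -
  define m where "m = ldiv x (n \<otimes> x)"
  have [simp]: "n \<in> carrier Q" "m \<in> carrier Q" "x \<otimes> m = n \<otimes> x" using n by (simp_all add: m_def)
  have m: "z \<otimes> x \<otimes> m = z \<otimes> n \<otimes> x" if "z \<in> carrier Q" for z
    using right_conjugacy_closed[of x n z m] that by simp
  have "m \<in> nucleus"
  proof (rule right_nuclearI)
    fix u v assume [simp]: "u \<in> carrier Q" "v \<in> carrier Q"
    define z where "z = rdiv v x"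
    have [simp]: "z \<in> carrier Q" "z \<otimes> x = v" by (simp_all add: z_def)
    obtain P where P: "P \<in> LMlt" "L u \<circ> R x = R x \<circ> P" using LMlt_semiconj_R[of "L u" x] by auto
    have "P \<in> perms" using autotopism_LMlt[OF P(1)] by (auto simp: autotopism_def)
    then have cl [simp]: "P t \<in> carrier Q" if "t \<in> carrier Q" for t using that by (simp add: perms_iff)
    have ux: "u \<otimes> (t \<otimes> x) = P t \<otimes> x" if "t \<in> carrier Q" for t
      using fun_cong[OF P(2), of t] that by simp
    have "P (z \<otimes> n) = P z \<otimes> n" using fun_cong[OF R_nucleus_LMlt[OF P(1) n], of z] by simp
    then have "u \<otimes> (v \<otimes> m) = P z \<otimes> n \<otimes> x" using m[of z] ux[of "z \<otimes> n"] by simp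
    also have "\<dots> = u \<otimes> v \<otimes> m" using m[of "P z"] ux[of z] by simp
    finally show "u \<otimes> v \<otimes> m = u \<otimes> (v \<otimes> m)" by simp
  qed simp
  then show ?thesis by (simp add: m_def)
qed

lemma nucleus_normal_left:
  assumes n: "n \<in> nucleus" and x [simp]: "x \<in> carrier Q"
  shows "rdiv (x \<otimes> n) x \<in> nucleus"
proof -
  define m where "m = rdiv (x \<otimes> n) x"
  have [simp]: "n \<in> carrier Q" "m \<in> carrier Q" "m \<otimes> x = x \<otimes> n" using n by (simp_all add: m_def)
  have m: "m \<otimes> (x \<otimes> z) = x \<otimes> (n \<otimes> z)" if "z \<in> carrier Q" for z
    using left_conjugacy_closed[of x n z m] that by simp
  have "m \<in> nucleus"
  proof (rule left_nuclearI)
    fix u v assume [simp]: "u \<in> carrier Q" "v \<in> carrier Q"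
    define z where "z = ldiv x u"
    have [simp]: "z \<in> carrier Q" "x \<otimes> z = u" by (simp_all add: z_def)
    obtain P where P: "P \<in> RMlt" "R v \<circ> L x = L x \<circ> P" using RMlt_semiconj_L[of "R v" x] by auto
    have "P \<in> perms" using autotopism_RMlt[OF P(1)] by (auto simp: autotopism_def)
    then have cl [simp]: "P t \<in> carrier Q" if "t \<in> carrier Q" for t using that by (simp add: perms_iff)
    have ux: "x \<otimes> t \<otimes> v = x \<otimes> P t" if "t \<in> carrier Q" for t
      using fun_cong[OF P(2), of t] that by simp
    have "P (n \<otimes> z) = n \<otimes> P z" using fun_cong[OF L_nucleus_RMlt[OF P(1) n], of z] by simp
    then have "m \<otimes> u \<otimes> v = x \<otimes> (n \<otimes> P z)" using m[of z] ux[of "n \<otimes> z"] by simp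
    also have "\<dots> = m \<otimes> (u \<otimes> v)" using m[of "P z"] ux[of z] by simp
    finally show "m \<otimes> u \<otimes> v = m \<otimes> (u \<otimes> v)" .
  qed simp
  then show ?thesis by (simp add: m_def)
qed

lemma nucleus_swap_right:
  assumes "n \<in> nucleus" "x \<in> carrier Q"
  obtains m where "m \<in> nucleus" "n \<otimes> x = x \<otimes> m"
  using that[OF nucleus_normal_right[OF assms]] assms by simp

lemma nucleus_swap_left:
  assumes "n \<in> nucleus" "x \<in> carrier Q"
  obtains m where "m \<in> nucleus" "x \<otimes> n = m \<otimes> x"
  using that[OF nucleus_normal_left[OF assms]] assms by simp

text \<open>The permutation \<open>R y \<circ> L x\<close> is also a product of
  \<open>L (x \<otimes> y)\<close>, the inverse of \<open>L y\<close>, and \<open>R y\<close>. The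
  two factorizations give autotopisms with the same third component, and their second components are
  compared at \<open>\<one>\<close>.\<close>

lemma commute_mod_nucleus:
  assumes [simp]: "x \<in> carrier Q" "y \<in> carrier Q"
  obtains n where "n \<in> nucleus" "y \<otimes> x = x \<otimes> y \<otimes> n"
proof -
  obtain A where A: "autotopism A (inv_into UNIV (L y) \<circ> R y \<circ> L x) (R y \<circ> L x)"
    using autotopism_comp[OF autotopism_R[of y] autotopism_L[of x]] by auto
  have eq: "L (x \<otimes> y) \<circ> (inv_into UNIV (L y) \<circ> R y) = R y \<circ> L x"
    using R_comp_L[of y x] by simp
  obtain A' where "autotopism A' (L (x \<otimes> y) \<circ> (inv_into UNIV (L y) \<circ> (inv_into UNIV (L y) \<circ> R y)))
    (L (x \<otimes> y) \<circ> (inv_into UNIV (L y) \<circ> R y))"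
    using autotopism_comp[OF autotopism_L[of "x \<otimes> y"]
        autotopism_comp[OF autotopism_inv[OF autotopism_L[of y]] autotopism_R[of y]]] by auto
  then have A': "autotopism A' (L (x \<otimes> y) \<circ> (inv_into UNIV (L y) \<circ> (inv_into UNIV (L y) \<circ> R y))) (R y \<circ> L x)"
    by (simp only: eq)
  obtain n where n: "n \<in> nucleus"
    and n_eq: "(L (x \<otimes> y) \<circ> (inv_into UNIV (L y) \<circ> (inv_into UNIV (L y) \<circ> R y))) \<one>
      = n \<otimes> (inv_into UNIV (L y) \<circ> R y \<circ> L x) \<one>"
    using autotopisms_same_third[OF A' A] one_closed by blast
  \<comment> \<open>The comparison at \<open>\<one>\<close> reads \<open>(x y) i = n s\<close>,
    where \<open>y s = x y\<close>. Since \<open>y i = \<one>\<close>, the left side is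
    \<open>x\<close> times an associator, so \<open>x\<close> and \<open>s\<close> agree modulo the
    nucleus; hence so do \<open>y x\<close> and \<open>y s = x y\<close>.\<close>
  define s i where "s = ldiv y (x \<otimes> y)" and "i = ldiv y \<one>"
  have [simp]: "s \<in> carrier Q" "i \<in> carrier Q" "y \<otimes> s = x \<otimes> y" "y \<otimes> i = \<one>"
    by (simp_all add: s_def i_def)
  have "ldiv y y = \<one>" using ldiv_mult[of y \<one>] by simp
  then have ns: "x \<otimes> y \<otimes> i = n \<otimes> s" using n_eq by (simp add: s_def i_def)
  define a where "a = associator x y i"
  have a: "a \<in> nucleus" and [simp]: "a \<in> carrier Q" by (simp_all add: a_def)
  have "x \<otimes> a = n \<otimes> s" using associator[of x y i] ns by (simp add: a_def)
  obtain a' where a': "a' \<in> nucleus" "a \<otimes> a' = \<one>" using nucleus_inverse[OF a] by blast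
  have "x \<otimes> a \<otimes> a' = x" using nucleus_right[OF a'(1), of x a] a' by simp
  then have "n \<otimes> s \<otimes> a' = x" using \<open>x \<otimes> a = n \<otimes> s\<close> by simp
  moreover obtain m where m: "m \<in> nucleus" "n \<otimes> s = s \<otimes> m" using nucleus_swap_right[OF n, of s] by auto
  ultimately have "x = s \<otimes> (m \<otimes> a')" using nucleus_right[of a' s m] a' by simp
  then have "y \<otimes> x = x \<otimes> y \<otimes> (m \<otimes> a')" using nucleus_right[of "m \<otimes> a'" y s] m a' by simp
  then show ?thesis using m a' by (intro that[of "m \<otimes> a'"]) simp_all
qed

section \<open>Associators as a symmetric function on the quotient by the nucleus\<close>

text \<open>The nuclear factor can be pulled out past the associator because associators are central
  in the nucleus.\<close>

lemma associator_nucleus_right: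
  assumes [simp]: "x \<in> carrier Q" "y \<in> carrier Q" "z \<in> carrier Q" and n: "n \<in> nucleus"
  shows "associator x y (z \<otimes> n) = associator x y z"
proof (rule associator_eqI)
  let ?a = "associator x y z"
  have [simp]: "?a \<in> nucleus" "n \<in> carrier Q" using n by simp_all
  have "x \<otimes> y \<otimes> (z \<otimes> n) = x \<otimes> y \<otimes> z \<otimes> n" using n by (intro nucleus_right[symmetric]) simp_all
  also have "\<dots> = x \<otimes> (y \<otimes> z) \<otimes> ?a \<otimes> n" using associator[of x y z] by simp
  also have "\<dots> = x \<otimes> (y \<otimes> z) \<otimes> (?a \<otimes> n)" using n by (intro nucleus_right) simp_all
  also have "?a \<otimes> n = n \<otimes> ?a" using n by (intro nucleus_center_comm) simp_all
  also have "x \<otimes> (y \<otimes> z) \<otimes> (n \<otimes> ?a) = x \<otimes> (y \<otimes> z) \<otimes> n \<otimes> ?a"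
    using n by (intro nucleus_middle[symmetric]) simp_all
  also have "x \<otimes> (y \<otimes> z) \<otimes> n = x \<otimes> (y \<otimes> z \<otimes> n)" using n by (intro nucleus_right) simp_all
  also have "y \<otimes> z \<otimes> n = y \<otimes> (z \<otimes> n)" using n by (intro nucleus_right) simp_all
  finally show "x \<otimes> y \<otimes> (z \<otimes> n) = x \<otimes> (y \<otimes> (z \<otimes> n)) \<otimes> ?a" .
qed (use n in simp_all)

text \<open>By normality, \<open>n\<close> passes across \<open>z\<close> and becomes a nuclear
  factor of the last argument.\<close>

lemma associator_nucleus_middle:
  assumes [simp]: "x \<in> carrier Q" "y \<in> carrier Q" "z \<in> carrier Q" and n: "n \<in> nucleus"
  shows "associator x (y \<otimes> n) z = associator x y z"
proof -
  obtain m where m: "m \<in> nucleus" "n \<otimes> z = z \<otimes> m" using nucleus_swap_right[OF n, of z] by auto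
  have "x \<otimes> (y \<otimes> n) \<otimes> z = x \<otimes> y \<otimes> (z \<otimes> m)"
    using nucleus_right[OF n, of x y] nucleus_middle[OF n, of "x \<otimes> y" z] m by simp
  moreover have "y \<otimes> n \<otimes> z = y \<otimes> (z \<otimes> m)"
    using nucleus_middle[OF n, of y z] m by simp
  ultimately have "associator x (y \<otimes> n) z = associator x y (z \<otimes> m)"
    by (simp add: associator_def)
  then show ?thesis using m by (simp add: associator_nucleus_right)
qed

lemma associator_nucleus_left:
  assumes [simp]: "x \<in> carrier Q" "y \<in> carrier Q" "z \<in> carrier Q" and n: "n \<in> nucleus"
  shows "associator (x \<otimes> n) y z = associator x y z"
proof -
  obtain m where m: "m \<in> nucleus" "n \<otimes> y = y \<otimes> m" using nucleus_swap_right[OF n, of y] by auto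
  have "x \<otimes> n \<otimes> y = x \<otimes> (y \<otimes> m)" using nucleus_middle[OF n, of x y] m by simp
  moreover have "x \<otimes> n \<otimes> (y \<otimes> z) = x \<otimes> (y \<otimes> m \<otimes> z)"
    using nucleus_middle[OF n, of x "y \<otimes> z"] nucleus_left[OF n, of y z] m by simp
  ultimately have "associator (x \<otimes> n) y z = associator x (y \<otimes> m) z"
    by (simp add: associator_def)
  then show ?thesis using m by (simp add: associator_nucleus_middle)
qed

text \<open>With \<open>f x = x y\<close>, conjugacy closedness also gives
  \<open>f (x z) = x (y z)\<close>, so the triples \<open>f, x, z\<close> and \<open>x, y, z\<close>
  have equal associators. Commutativity modulo the nucleus makes \<open>f\<close> a nuclear multiple
  of \<open>y\<close>.\<close>

lemma associator_comm_left:
  assumes [simp]: "x \<in> carrier Q" "y \<in> carrier Q" "z \<in> carrier Q"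
  shows "associator x y z = associator y x z"
proof -
  define f where "f = rdiv (x \<otimes> y) x"
  have [simp]: "f \<in> carrier Q" "f \<otimes> x = x \<otimes> y" by (simp_all add: f_def)
  obtain n where n: "n \<in> nucleus" "x \<otimes> y = y \<otimes> x \<otimes> n" using commute_mod_nucleus[of y x] by auto
  obtain m where m: "m \<in> nucleus" "x \<otimes> n = m \<otimes> x" using nucleus_swap_left[OF n(1), of x] by auto
  have "f \<otimes> x = y \<otimes> m \<otimes> x"
    using n m nucleus_right[of n y x] nucleus_middle[of m y x] by simp
  then have "f = y \<otimes> m" using m by (subst (asm) r_cancel) simp_all
  have "associator f x z = associator x y z"
    using left_conjugacy_closed[of x y z f] by (simp add: associator_def)
  then show ?thesis using \<open>f = y \<otimes> m\<close> m by (simp add: associator_nucleus_left)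
qed

lemma associator_comm_right:
  assumes [simp]: "x \<in> carrier Q" "y \<in> carrier Q" "z \<in> carrier Q"
  shows "associator x y z = associator x z y"
proof -
  obtain n where n: "n \<in> nucleus" "y \<otimes> z = z \<otimes> y \<otimes> n" using commute_mod_nucleus[of z y] by auto
  define g where "g = y \<otimes> n"
  have [simp]: "g \<in> carrier Q" and g: "z \<otimes> g = y \<otimes> z"
    using n nucleus_right[of n z y] by (simp_all add: g_def)
  have "associator x z g = associator x y z"
    using right_conjugacy_closed[of z y x g] g by (simp add: associator_def)
  then show ?thesis using n by (simp add: g_def associator_nucleus_right)
qed

lemma associator_mult_comm:
  assumes "x \<in> carrier Q" "y \<in> carrier Q" "z \<in> carrier Q" "w \<in> carrier Q"
  shows "associator (x \<otimes> y) z w = associator (y \<otimes> x) z w"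
proof -
  obtain n where n: "n \<in> nucleus" "y \<otimes> x = x \<otimes> y \<otimes> n" using commute_mod_nucleus assms by blast
  then show ?thesis using assms by (simp add: associator_nucleus_left)
qed

section \<open>Conjugation action and the cocycle identity\<close>

text \<open>The conjugate of \<open>c\<close> by \<open>w\<close> in the right-action convention: a
  nuclear factor \<open>c\<close> standing left of \<open>w\<close> becomes
  \<open>conj_act c w\<close> when moved to its right.\<close>

definition conj_act :: "'a \<Rightarrow> 'a \<Rightarrow> 'a"
  where "conj_act c w = ldiv w (c \<otimes> w)"

lemma mult_conj_act:
  "c \<in> carrier Q \<Longrightarrow> w \<in> carrier Q \<Longrightarrow> w \<otimes> conj_act c w = c \<otimes> w"
  by (simp add: conj_act_def)

lemma conj_act_nucleus [simp]:
  "n \<in> nucleus \<Longrightarrow> w \<in> carrier Q \<Longrightarrow> conj_act n w \<in> nucleus"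
  by (simp add: conj_act_def nucleus_normal_right)

lemma conj_act_mult:
  assumes c: "c \<in> nucleus" and d: "d \<in> nucleus" and [simp]: "w \<in> carrier Q"
  shows "conj_act (c \<otimes> d) w = conj_act c w \<otimes> conj_act d w"
proof -
  have "w \<otimes> (conj_act c w \<otimes> conj_act d w) = w \<otimes> conj_act c w \<otimes> conj_act d w"
    using c d by (intro nucleus_right[symmetric]) simp_all
  also have "\<dots> = c \<otimes> w \<otimes> conj_act d w" using c by (simp add: mult_conj_act)
  also have "\<dots> = c \<otimes> (w \<otimes> conj_act d w)" using c d by (intro nucleus_left) simp_all
  also have "w \<otimes> conj_act d w = d \<otimes> w" using d by (simp add: mult_conj_act)
  also have "c \<otimes> (d \<otimes> w) = c \<otimes> d \<otimes> w" using c d by (intro nucleus_left[symmetric]) simp_all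
  finally have "ldiv w (c \<otimes> d \<otimes> w) = ldiv w (w \<otimes> (conj_act c w \<otimes> conj_act d w))" by simp
  also have "\<dots> = conj_act c w \<otimes> conj_act d w" using c d by (intro ldiv_mult) simp_all
  finally show ?thesis by (simp add: conj_act_def)
qed

text \<open>Conjugation by \<open>w\<close> is multiplicative on the nucleus and, by normality on
  the other side, onto it; hence it preserves central elements.\<close>

lemma conj_act_center [simp]:
  assumes c: "c \<in> nucleus_center" and w [simp]: "w \<in> carrier Q"
  shows "conj_act c w \<in> nucleus_center"
proof -
  have "conj_act c w \<otimes> n = n \<otimes> conj_act c w" if n: "n \<in> nucleus" for n
  proof -
    obtain m where m: "m \<in> nucleus" "w \<otimes> n = m \<otimes> w" using nucleus_swap_left[OF n w] .
    have "n = conj_act m w" using m n ldiv_mult[of w n] by (simp add: conj_act_def)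
    then show ?thesis
      using conj_act_mult[of c m w] conj_act_mult[of m c w] m c nucleus_center_comm[of c m] by simp
  qed
  then show ?thesis using c w unfolding nucleus_center_def by simp
qed

text \<open>The two sides of the pentagon: \<open>((x y) z) w\<close> is reduced to
  \<open>x (y (z w))\<close> along both rebracketing paths. The conjugation appears where
  \<open>associator x y z\<close> has to pass \<open>w\<close>.\<close>

lemma associator_cocycle:
  assumes [simp]: "x \<in> carrier Q" "y \<in> carrier Q" "z \<in> carrier Q" "w \<in> carrier Q"
  shows "associator x y (z \<otimes> w) \<otimes> associator (x \<otimes> y) z w
    = associator y z w \<otimes> associator x (y \<otimes> z) w \<otimes> conj_act (associator x y z) w"
proof -
  define t where "t = x \<otimes> (y \<otimes> (z \<otimes> w))"
  define a where "a = associator x y z"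
  define b where "b = conj_act a w"
  define c where "c = associator x (y \<otimes> z) w"
  define d where "d = associator y z w"
  define e where "e = associator x y (z \<otimes> w)"
  define f where "f = associator (x \<otimes> y) z w"
  have N: "a \<in> nucleus" "b \<in> nucleus" "c \<in> nucleus" "d \<in> nucleus" "e \<in> nucleus" "f \<in> nucleus"
    by (simp_all add: a_def b_def c_def d_def e_def f_def)
  have [simp]: "t \<in> carrier Q" by (simp add: t_def)
  note [simp] = N[THEN nucleus_closed]
  have "x \<otimes> y \<otimes> z \<otimes> w = x \<otimes> y \<otimes> (z \<otimes> w) \<otimes> f" by (simp add: associator[of "x \<otimes> y" z w] f_def)
  also have "x \<otimes> y \<otimes> (z \<otimes> w) = t \<otimes> e" by (simp add: associator[of x y "z \<otimes> w"] t_def e_def)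
  also have "t \<otimes> e \<otimes> f = t \<otimes> (e \<otimes> f)" using N by (intro nucleus_right) simp_all
  finally have 1: "x \<otimes> y \<otimes> z \<otimes> w = t \<otimes> (e \<otimes> f)" .
  have "x \<otimes> y \<otimes> z \<otimes> w = x \<otimes> (y \<otimes> z) \<otimes> a \<otimes> w" by (simp add: associator[of x y z] a_def)
  also have "\<dots> = x \<otimes> (y \<otimes> z) \<otimes> (a \<otimes> w)" using N by (intro nucleus_middle) simp_all
  also have "a \<otimes> w = w \<otimes> b" by (simp add: b_def mult_conj_act)
  also have "x \<otimes> (y \<otimes> z) \<otimes> (w \<otimes> b) = x \<otimes> (y \<otimes> z) \<otimes> w \<otimes> b" using N by (intro nucleus_right[symmetric]) simp_all
  also have "x \<otimes> (y \<otimes> z) \<otimes> w = x \<otimes> (y \<otimes> z \<otimes> w) \<otimes> c"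
    by (simp add: associator[of x "y \<otimes> z" w] c_def)
  also have "y \<otimes> z \<otimes> w = y \<otimes> (z \<otimes> w) \<otimes> d" by (simp add: associator[of y z w] d_def)
  also have "x \<otimes> (y \<otimes> (z \<otimes> w) \<otimes> d) = t \<otimes> d" unfolding t_def using N by (intro nucleus_right[symmetric]) simp_all
  also have "t \<otimes> d \<otimes> c = t \<otimes> (d \<otimes> c)" using N by (intro nucleus_right) simp_all
  also have "t \<otimes> (d \<otimes> c) \<otimes> b = t \<otimes> (d \<otimes> c \<otimes> b)" using N by (intro nucleus_right) simp_all
  finally have "t \<otimes> (e \<otimes> f) = t \<otimes> (d \<otimes> c \<otimes> b)" by (simp only: 1)
  then have "e \<otimes> f = d \<otimes> c \<otimes> b" by (subst (asm) l_cancel) simp_all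
  then show ?thesis by (simp add: a_def b_def c_def d_def e_def f_def)
qed

section \<open>The order of the center of the nucleus, and the conclusion\<close>

lemma nucleus_center_comm_group: "comm_group (Q\<lparr>carrier := nucleus_center\<rparr>)"
proof (rule comm_groupI, goal_cases)
  case (1 c d)
  then have N: "c \<in> nucleus" "d \<in> nucleus" by simp_all
  have "c \<otimes> d \<otimes> n = n \<otimes> (c \<otimes> d)" if n: "n \<in> nucleus" for n
  proof -
    have "c \<otimes> d \<otimes> n = c \<otimes> (d \<otimes> n)" using N n by (intro nucleus_left) simp_all
    also have "d \<otimes> n = n \<otimes> d" using 1 n by (intro nucleus_center_comm) simp_all
    also have "c \<otimes> (n \<otimes> d) = c \<otimes> n \<otimes> d" using N n by (intro nucleus_left[symmetric]) simp_all
    also have "c \<otimes> n = n \<otimes> c" using 1 n by (intro nucleus_center_comm) simp_all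
    also have "n \<otimes> c \<otimes> d = n \<otimes> (c \<otimes> d)" using N n by (intro nucleus_left) simp_all
    finally show ?thesis .
  qed
  then show ?case using N by (simp add: nucleus_center_def del: nucleus_center_nucleus)
next
  case 2
  then show ?case by (simp add: nucleus_center_def del: nucleus_center_nucleus)
next
  case (3 c d e)
  then show ?case by (simp add: nucleus_left)
next
  case (4 c d)
  then show ?case by (auto intro: nucleus_center_comm)
next
  case (5 c)
  then show ?case by simp
next
  case (6 c)
  then have c: "c \<in> nucleus_center" "c \<in> nucleus" by simp_all
  obtain d where d: "d \<in> nucleus" "d \<otimes> c = \<one>" "c \<otimes> d = \<one>" using nucleus_inverse[OF c(2)] .
  have "d \<otimes> n = n \<otimes> d" if n: "n \<in> nucleus" for n
  proof -
    have "c \<otimes> (d \<otimes> n) = n" using nucleus_left[of c d n] c d n by simp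
    also have "n = n \<otimes> c \<otimes> d" using nucleus_right[of d n c] c d n by simp
    also have "n \<otimes> c = c \<otimes> n" using c n by (intro nucleus_center_comm[symmetric])
    also have "c \<otimes> n \<otimes> d = c \<otimes> (n \<otimes> d)" using c d n by (intro nucleus_left) simp_all
    finally show ?thesis using c d n by (subst (asm) l_cancel) simp_all
  qed
  then have "d \<in> nucleus_center" using d unfolding nucleus_center_def by simp
  then show ?case using d by auto
qed

text \<open>Lagrange's argument works for nuclear subgroups: \<open>(x h) k = x (h k)\<close> makes
  the sets \<open>x H\<close> a partition of the loop into blocks of equal size.\<close>

lemma card_nuclear_subgroup_dvd:
  assumes fin: "finite (carrier Q)" and H: "H \<subseteq> nucleus" and group: "group (Q\<lparr>carrier := H\<rparr>)"
  shows "card H dvd order Q"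
proof -
  interpret H: group "Q\<lparr>carrier := H\<rparr>" by (rule group)
  have HQ: "h \<in> carrier Q" if "h \<in> H" for h using that H by auto
  have assoc: "x \<otimes> h \<otimes> k = x \<otimes> (h \<otimes> k)" if "x \<in> carrier Q" "h \<in> H" "k \<in> H" for x h k
    using that H by (intro nucleus_middle) auto
  define coset where "coset x = (\<lambda>h. x \<otimes> h) ` H" for x
  have sub: "coset x \<subseteq> coset y"
    if xy: "x \<in> carrier Q" "y \<in> carrier Q" and ne: "coset x \<inter> coset y \<noteq> {}" for x y
  proof -
    obtain h k where hk: "h \<in> H" "k \<in> H" "x \<otimes> h = y \<otimes> k" using ne by (auto simp: coset_def)
    obtain h' where h': "h' \<in> H" "h \<otimes> h' = \<one>" using H.r_inv_ex[of h] hk(1) by auto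
    have "x = x \<otimes> h \<otimes> h'" using assoc[of x h h'] xy hk h' by simp
    also have "\<dots> = y \<otimes> (k \<otimes> h')" using assoc[of y k h'] xy hk h' by simp
    finally have x: "x = y \<otimes> (k \<otimes> h')" .
    have kh': "k \<otimes> h' \<in> H" using H.m_closed[of k h'] hk h' by simp
    show ?thesis
    proof
      fix u assume "u \<in> coset x"
      then obtain l where l: "l \<in> H" "u = x \<otimes> l" by (auto simp: coset_def)
      have "u = y \<otimes> (k \<otimes> h' \<otimes> l)" using assoc[of y "k \<otimes> h'" l] kh' l xy x by simp
      moreover have "k \<otimes> h' \<otimes> l \<in> H" using H.m_closed[of "k \<otimes> h'" l] kh' l by simp
      ultimately show "u \<in> coset y" by (auto simp: coset_def)
    qed
  qed
  have cover: "\<Union> (coset ` carrier Q) = carrier Q"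
  proof
    show "carrier Q \<subseteq> \<Union> (coset ` carrier Q)"
      using H.one_closed by (force simp: coset_def intro: rev_image_eqI[of \<one>])
  qed (auto simp: coset_def HQ)
  have "card H dvd card (\<Union> (coset ` carrier Q))"
  proof (rule dvd_partition)
    show "\<forall>c \<in> coset ` carrier Q. card H dvd card c"
    proof
      fix c assume "c \<in> coset ` carrier Q"
      then obtain x where x: "x \<in> carrier Q" "c = coset x" by auto
      have "inj_on (\<lambda>h. x \<otimes> h) H" using x HQ by (auto intro!: inj_onI)
      then show "card H dvd card c" using x by (simp add: coset_def card_image)
    qed
    show "\<forall>c1 \<in> coset ` carrier Q. \<forall>c2 \<in> coset ` carrier Q. c1 \<noteq> c2 \<longrightarrow> c1 \<inter> c2 = {}"
      using sub by (metis (no_types, opaque_lifting) imageE inf_commute subset_antisym)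
  qed (use fin cover in simp)
  then show ?thesis using cover by (simp add: order_def)
qed

lemma associator_trivial:
  assumes fin: "finite (carrier Q)" and coprime: "coprime (order Q) 6"
    and cube: "\<And>x. x \<in> carrier Q \<Longrightarrow> x \<otimes> x \<otimes> x = x \<otimes> (x \<otimes> x)"
    and xyz: "x \<in> carrier Q" "y \<in> carrier Q" "z \<in> carrier Q"
  shows "associator x y z = \<one>"
proof -
  let ?M = "Q\<lparr>carrier := nucleus_center\<rparr>"
  have one_M: "\<one>\<^bsub>?M\<^esub> = \<one>" by simp
  interpret M: comm_group ?M by (rule nucleus_center_comm_group)
  have "card nucleus_center dvd order Q"
    by (rule card_nuclear_subgroup_dvd[OF fin _ M.group_axioms]) auto
  then have order_M: "order ?M dvd order Q" by (simp add: order_def)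
  \<comment> \<open>The order of such a \<open>c\<close> divides both 6 and the order of the
    loop.\<close>
  have torsion: "c = \<one>" if c: "c \<in> nucleus_center" and pow: "c [^]\<^bsub>?M\<^esub> k = \<one>" and k: "k dvd 6" for c and k :: nat
  proof -
    have "M.ord c dvd k" using M.pow_eq_id[of c k] c pow by simp
    then have "M.ord c dvd 6" using k by (rule dvd_trans)
    moreover have "M.ord c dvd order Q"
      using M.ord_dvd_group_order[of c] c order_M by (auto intro: dvd_trans)
    ultimately have "M.ord c = 1" using coprime_common_divisor_nat[OF coprime] by blast
    then show ?thesis using M.ord_eq_1[of c] c by simp
  qed
  have pow: "c [^]\<^bsub>?M\<^esub> (2::nat) = c \<otimes> c" "c [^]\<^bsub>?M\<^esub> (3::nat) = c \<otimes> c \<otimes> c"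
    if "c \<in> nucleus_center" for c
    using that by (simp_all add: numeral_2_eq_2 numeral_3_eq_3)
  interpret A: alternating_symmetric_cocycle ?M "carrier Q" "(\<otimes>)" associator conj_act
  proof unfold_locales
    fix c assume c: "c \<in> carrier ?M"
    show "c = \<one>\<^bsub>?M\<^esub>" if "c \<otimes>\<^bsub>?M\<^esub> c = \<one>\<^bsub>?M\<^esub>" using torsion[of c 2] pow[of c] c that by simp
    show "c = \<one>\<^bsub>?M\<^esub>" if "c \<otimes>\<^bsub>?M\<^esub> c \<otimes>\<^bsub>?M\<^esub> c = \<one>\<^bsub>?M\<^esub>" using torsion[of c 3] pow[of c] c that by simp
  next
    fix x y z assume xyz: "x \<in> carrier Q" "y \<in> carrier Q" "z \<in> carrier Q"
    show "associator x y z = associator y x z" using xyz by (rule associator_comm_left)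
    show "associator x y z = associator x z y" using xyz by (rule associator_comm_right)
  next
    fix x y z w assume "x \<in> carrier Q" "y \<in> carrier Q" "z \<in> carrier Q" "w \<in> carrier Q"
    then show "associator (x \<otimes> y) z w = associator (y \<otimes> x) z w" by (rule associator_mult_comm)
  qed (simp_all add: conj_act_mult associator_cocycle associator_eqI cube)
  have "associator x y z = \<one>\<^bsub>?M\<^esub>" using xyz by (rule A.a_trivial)
  then show ?thesis by (simp only: one_M)
qed

theorem group_if_coprime_6:
  assumes fin: "finite (carrier Q)" and coprime: "coprime (order Q) 6"
    and cube: "\<And>x. x \<in> carrier Q \<Longrightarrow> x \<otimes> x \<otimes> x = x \<otimes> (x \<otimes> x)"
  shows "group Q"
proof (rule groupI)
  fix x y z assume xyz: "x \<in> carrier Q" "y \<in> carrier Q" "z \<in> carrier Q"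
  have "associator x y z = \<one>" by (rule associator_trivial[OF fin coprime cube xyz])
  then show "x \<otimes> y \<otimes> z = x \<otimes> (y \<otimes> z)" using associator[OF xyz] xyz by simp
next
  fix x assume "x \<in> carrier Q"
  then show "\<exists>y \<in> carrier Q. y \<otimes> x = \<one>" by (intro bexI[of _ "rdiv \<one> x"]) simp_all
qed simp_all

end

theorem corollary7p7:
  fixes Q :: "('a, 'b) monoid_scheme"
  assumes "cc_loop Q"
    and "power_associative Q"
    and "finite (carrier Q)"
    and "coprime (order Q) 6"
  shows "group Q"
proof -
  interpret cc_loop Q by fact
  show ?thesis
  proof (rule group_if_coprime_6)
    fix x assume x: "x \<in> carrier Q"
    \<comment> \<open>Power-associativity enters through the identity
      \<open>(x x) x = x (x x)\<close>, read off inside the group generated by \<open>x\<close>; it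
      makes the associator vanish on the diagonal.\<close>
    define H where "H = subloop_generated Q {x}"
    have "x \<in> H" by (simp add: H_def subloop_generated_def)
    moreover have "group (Q\<lparr>carrier := H\<rparr>)"
      using assms(2) x by (simp add: H_def power_associative_def)
    ultimately show "x \<otimes>\<^bsub>Q\<^esub> x \<otimes>\<^bsub>Q\<^esub> x = x \<otimes>\<^bsub>Q\<^esub> (x \<otimes>\<^bsub>Q\<^esub> x)"
      using group.is_monoid[THEN monoid.m_assoc, of "Q\<lparr>carrier := H\<rparr>" x x x] by simp
  qed fact+
qed

end
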